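(* Let $2\leq r\leq\infty$ and let $\psi:\mathbb{F}_r\to\mathbb{C}$ be a radial function with $\psi(e)=0$. The following are equivalent. (1) The function $\psi$ is conditionally negative definite. (2) There is a finite positive Borel measure $\nu$ on $[-1,1]$ such that $$\psi(x)=\int_{-1}^1\psi_s(x)\,d\nu(s),\qquad x\in\mathbb{F}_r,$$ where $$\psi_s(x)=\frac{1-\phi_s(x)}{1-s},\quad s\in\mathbb{C}\setminus\{1\},\qquad\text{and}\qquad \psi_1(x)=\lim_{s\to1}\frac{1-\phi_s(x)}{1-s},$$ and $\phi_s$ denotes the spherical function on $\mathbb{F}_r$ with eigenvalue $s$. Moreover, if (2) holds, then $\nu$ is uniquely determined by $\psi$, and $\nu([-1,1])=\psi(x)$ when $|x|=1$.
   Context: For $2\leq r\leq\infty$, $\mathbb{F}_r$ is the free group on $r$ generators (countably infinitely many if $r=\infty$), $e$ is its identity, and $|x|$ is the word length of $x\in\mathbb{F}_r$ with respect to the free generators. A function $\phi:\mathbb{F}_r\to\mathbb{C}$ is radial if $\phi(x)$ depends only on $|x|$; then $\phi(x)=\dot\phi(|x|)$ for a unique $\dot\phi:\mathbb{N}_0\to\mathbb{C}$. Spherical functions: for $s\in\mathbb{C}$, the spherical function $\phi_s$ on $\mathbb{F}_r$ with eigenvalue $s$ is the radial function defined as follows. If $r<\infty$, put $q=2r-1$; then $\phi_s$ is the unique radial function with $\phi_s(e)=1$ such that for every $x$ the average of $\phi_s$ over the $q+1$ neighbours of $x$ in the Cayley graph of $\mathbb{F}_r$ (with respect to the free generators) equals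 $s\phi_s(x)$. Equivalently, $\dot\phi_s(0)=1$, $\dot\phi_s(1)=s$, and $\dot\phi_s(n+1)=\frac{q+1}{q}s\,\dot\phi_s(n)-\frac1q\dot\phi_s(n-1)$ for $n\geq1$; explicitly, $$\dot\phi_s(n)=\left[\frac{2}{q+1}T_n\left(\frac{q+1}{2\sqrt q}s\right)+\frac{q-1}{q+1}U_n\left(\frac{q+1}{2\sqrt q}s\right)\right]q^{-n/2},\qquad n\in\mathbb{N}_0,$$ where $T_n$, $U_n$ are the Chebyshev polynomials of the first and second kind. If $r=\infty$, then $\phi_s(x)=s^{|x|}$ (with $0^0=1$). For each fixed $x$, $\phi_s(x)$ is a polynomial in $s$ with value $1$ at $s=1$, so the limit defining $\psi_1(x)$ exists. A map $\psi:G\to\mathbb{C}$ on a group $G$ is conditionally negative definite if $\psi(x^{-1})=\overline{\psi(x)}$ for all $x\in G$ and $\sum_{j,k=1}^n c_j\overline{c_k}\,\psi(x_k^{-1}x_j)\leq0$ for all $n\in\mathbb{N}$, $x_1,\dots,x_n\in G$ and $c_1,\dots,c_n\in\mathbb{C}$ with $\sum_j c_j=0$. *)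

theory Defs
  imports "HOL-Analysis.Analysis" "HOL-Algebra.Group"
begin

section \<open>Free groups\<close>

text \<open>The letter \<open>(i, True)\<close> is the \<open>i\<close>-th free generator and \<open>(i, False)\<close> its inverse.
  The free group is modelled on reduced words, so the word length of an element with respect to the
  free generators is the \<^const>\<open>length\<close> of the list representing it.\<close>

type_synonym letter = "nat \<times> bool"
type_synonym fword = "letter list"

definition inv_letter :: "letter \<Rightarrow> letter" where
  "inv_letter a = (fst a, \<not> snd a)"

definition letters :: "enat \<Rightarrow> letter set" where
  "letters r = {a. enat (fst a) < r}"

definition reduced_word :: "fword \<Rightarrow> bool" where
  "reduced_word w \<longleftrightarrow> successively (\<lambda>a b. b \<noteq> inv_letter a) w"

fun cancel_Cons :: "letter \<Rightarrow> fword \<Rightarrow> fword" where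
  "cancel_Cons a [] = [a]"
| "cancel_Cons a (b # w) = (if b = inv_letter a then w else a # b # w)"

definition free_group :: "enat \<Rightarrow> fword monoid" where
  "free_group r =
     \<lparr>carrier = {w. reduced_word w \<and> set w \<subseteq> letters r}, mult = foldr cancel_Cons, one = []\<rparr>"

lemma inv_letter_simps [simp]:
  "inv_letter (inv_letter a) = a" "inv_letter a \<noteq> a" "a \<noteq> inv_letter a"
  "inv_letter a = inv_letter b \<longleftrightarrow> a = b"
  "inv_letter a \<in> letters r \<longleftrightarrow> a \<in> letters r"
  by (auto simp: inv_letter_def letters_def prod_eq_iff)

lemma reduced_Nil [simp]: "reduced_word []"
  by (simp add: reduced_word_def)

lemma reduced_Cons: "reduced_word (a # w) \<longleftrightarrow> w = [] \<or> hd w \<noteq> inv_letter a \<and> reduced_word w"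
  by (cases w) (auto simp: reduced_word_def)

lemma reduced_append:
  "reduced_word (u @ v) \<longleftrightarrow>
     reduced_word u \<and> reduced_word v \<and> (u = [] \<or> v = [] \<or> hd v \<noteq> inv_letter (last u))"
  by (auto simp: reduced_word_def successively_append_iff)

lemma reduced_cancel_Cons: "reduced_word w \<Longrightarrow> reduced_word (cancel_Cons a w)"
  by (cases w) (auto simp: reduced_Cons)

lemma cancel_Cons_inv:
  assumes "reduced_word w"
  shows "cancel_Cons (inv_letter a) (cancel_Cons a w) = w"
  using assms by (cases w rule: list.exhaust; cases "tl w") (auto simp: reduced_Cons)

lemma set_cancel_Cons: "set (cancel_Cons a w) \<subseteq> insert a (set w)"
  by (cases w) auto

lemma reduced_foldr: "reduced_word w \<Longrightarrow> reduced_word (foldr cancel_Cons u w)"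
  by (induction u) (auto intro: reduced_cancel_Cons)

lemma set_foldr: "set (foldr cancel_Cons u w) \<subseteq> set u \<union> set w"
  by (induction u) (use set_cancel_Cons in fastforce)+

lemma foldr_cancel_Cons:
  assumes "reduced_word z"
  shows "foldr cancel_Cons (cancel_Cons a w) z = cancel_Cons a (foldr cancel_Cons w z)"
proof (cases w)
  case (Cons b v)
  then show ?thesis
    using cancel_Cons_inv[OF reduced_foldr[OF assms], of "inv_letter a" v] by auto
qed simp

lemma foldr_assoc:
  "reduced_word z \<Longrightarrow>
    foldr cancel_Cons (foldr cancel_Cons x y) z = foldr cancel_Cons x (foldr cancel_Cons y z)"
  by (induction x) (simp_all add: foldr_cancel_Cons)

lemma foldr_reduced: "reduced_word (u @ v) \<Longrightarrow> foldr cancel_Cons u v = u @ v"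
proof (induction u)
  case (Cons a u)
  then have "reduced_word (u @ v)"
    by (cases "u @ v") (auto simp: reduced_Cons)
  with Cons show ?case
    by (cases "u @ v") (auto simp: reduced_Cons)
qed simp

lemma foldr_left_inv:
  "reduced_word z \<Longrightarrow> foldr cancel_Cons (rev (map inv_letter x)) (foldr cancel_Cons x z) = z"
  by (induction x) (simp_all add: cancel_Cons_inv reduced_foldr)

lemma reduced_rev_inv: "reduced_word (rev (map inv_letter x)) \<longleftrightarrow> reduced_word x"
proof (induction x)
  case (Cons a x)
  then show ?case
    by (cases x) (auto simp: reduced_append reduced_Cons last_rev hd_map)
qed simp

lemma group_free_group: "group (free_group r)"
proof (rule groupI)
  fix x y assume "x \<in> carrier (free_group r)" "y \<in> carrier (free_group r)"
  then show "x \<otimes>\<^bsub>free_group r\<^esub> y \<in> carrier (free_group r)"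
    using set_foldr[of x y] by (auto simp: free_group_def intro: reduced_foldr)
next
  fix x assume x: "x \<in> carrier (free_group r)"
  have "rev (map inv_letter x) \<in> carrier (free_group r)"
    using x by (auto simp: free_group_def reduced_rev_inv)
  moreover have "rev (map inv_letter x) \<otimes>\<^bsub>free_group r\<^esub> x = \<one>\<^bsub>free_group r\<^esub>"
    using foldr_left_inv[of "[]" x] foldr_reduced[of x "[]"] x by (simp add: free_group_def)
  ultimately show "\<exists>y\<in>carrier (free_group r). y \<otimes>\<^bsub>free_group r\<^esub> x = \<one>\<^bsub>free_group r\<^esub>"
    by blast
qed (auto simp: free_group_def foldr_assoc)

definition radial :: "enat \<Rightarrow> (fword \<Rightarrow> complex) \<Rightarrow> bool" where
  "radial r \<phi> \<longleftrightarrow>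
     (\<forall>x\<in>carrier (free_group r). \<forall>y\<in>carrier (free_group r). length x = length y \<longrightarrow> \<phi> x = \<phi> y)"


section \<open>Conditionally negative definite functions\<close>

definition cond_neg_def :: "('a, 'b) monoid_scheme \<Rightarrow> ('a \<Rightarrow> complex) \<Rightarrow> bool" where
  "cond_neg_def G \<psi> \<longleftrightarrow>
     (\<forall>x\<in>carrier G. \<psi> (inv\<^bsub>G\<^esub> x) = cnj (\<psi> x)) \<and>
     (\<forall>(n::nat) (x :: nat \<Rightarrow> 'a) (c :: nat \<Rightarrow> complex).
        (\<forall>j<n. x j \<in> carrier G) \<and> (\<Sum>j<n. c j) = 0 \<longrightarrow>
        (\<Sum>j<n. \<Sum>k<n. c j * cnj (c k) * \<psi> (inv\<^bsub>G\<^esub> (x k) \<otimes>\<^bsub>G\<^esub> x j)) \<in> \<real>\<^sub>\<le>\<^sub>0)"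


section \<open>Spherical functions\<close>

definition neighbours :: "enat \<Rightarrow> fword \<Rightarrow> fword set" where
  "neighbours r x = (\<lambda>a. x \<otimes>\<^bsub>free_group r\<^esub> [a]) ` letters r"

definition spherical_eq :: "enat \<Rightarrow> complex \<Rightarrow> (nat \<Rightarrow> complex) \<Rightarrow> bool" where
  "spherical_eq r s f \<longleftrightarrow> f 0 = 1 \<and>
     (\<forall>x\<in>carrier (free_group r).
        (\<Sum>y\<in>neighbours r x. f (length y)) / of_nat (card (neighbours r x)) = s * f (length x))"

text \<open>A radial function is given by its profile, a function of the word length.  For finite rank
  at least 2 the description below determines the profile uniquely; see \<open>ex1_spherical_eq\<close>.\<close>

definition spherical_dot :: "enat \<Rightarrow> complex \<Rightarrow> nat \<Rightarrow> complex" where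
  "spherical_dot r s = (if r = \<infinity> then (\<lambda>n. s ^ n) else (THE f. spherical_eq r s f))"

definition spherical :: "enat \<Rightarrow> complex \<Rightarrow> fword \<Rightarrow> complex" where
  "spherical r s x = spherical_dot r s (length x)"

definition psi_sph :: "enat \<Rightarrow> complex \<Rightarrow> fword \<Rightarrow> complex" where
  "psi_sph r s x =
     (if s = 1 then Lim (at 1) (\<lambda>t. (1 - spherical r t x) / (1 - t))
      else (1 - spherical r s x) / (1 - s))"

text \<open>\<open>\<nu>\<close> is a finite Borel measure with underlying space \<open>[-1, 1]\<close> that represents \<open>\<psi>\<close>.\<close>

definition represents :: "enat \<Rightarrow> real measure \<Rightarrow> (fword \<Rightarrow> complex) \<Rightarrow> bool" where
  "represents r \<nu> \<psi> \<longleftrightarrow>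
     sets \<nu> = sets (restrict_space borel {-1..1}) \<and> finite_measure \<nu> \<and>
     (\<forall>x\<in>carrier (free_group r). \<psi> x = (LINT s|\<nu>. psi_sph r (complex_of_real s) x))"


subsection \<open>Well-definedness for finite rank\<close>

lemma letters_enat: "letters (enat n) = {..<n} \<times> UNIV"
  by (auto simp: letters_def)

lemma mult_letter:
  assumes "reduced_word x"
  shows "x \<otimes>\<^bsub>free_group r\<^esub> [a] =
    (if x \<noteq> [] \<and> a = inv_letter (last x) then butlast x else x @ [a])"
proof (cases "x \<noteq> [] \<and> a = inv_letter (last x)")
  case True
  then obtain u b where x: "x = u @ [b]" and a: "a = inv_letter b"
    by (metis append_butlast_last_id)
  have "reduced_word u"
    using assms x by (simp add: reduced_append)
  then show ?thesis
    using foldr_reduced[of u "[]"] by (simp add: x a free_group_def)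
next
  case False
  then have "reduced_word (x @ [a])"
    using assms by (auto simp: reduced_append reduced_Cons)
  then show ?thesis
    unfolding if_not_P[OF False] using foldr_reduced[of x "[a]"] by (simp add: free_group_def)
qed

lemma inj_mult_letter:
  "inj_on (\<lambda>a. x \<otimes>\<^bsub>free_group r\<^esub> [a]) A"
proof (rule inj_onI)
  fix a b assume "x \<otimes>\<^bsub>free_group r\<^esub> [a] = x \<otimes>\<^bsub>free_group r\<^esub> [b]"
  then have eq: "foldr cancel_Cons x [a] = foldr cancel_Cons x [b]"
    by (simp add: free_group_def)
  have "reduced_word [c]" for c
    by (simp add: reduced_Cons)
  from foldr_left_inv[OF this] have "[a] = [b]"
    by (metis eq)
  then show "a = b"
    by simp
qed

lemma card_neighbours:
  assumes "x \<in> carrier (free_group (enat n))"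
  shows "card (neighbours (enat n) x) = 2 * n"
proof -
  show ?thesis
    unfolding neighbours_def
    by (subst card_image[OF inj_mult_letter]) (simp_all add: letters_enat card_cartesian_product)
qed

lemma sum_neighbours:
  fixes f :: "nat \<Rightarrow> complex"
  assumes "x \<in> carrier (free_group (enat n))" "n \<ge> 1"
  shows "(\<Sum>y\<in>neighbours (enat n) x. f (length y)) =
    (if x = [] then of_nat (2 * n) * f 1
     else f (length x - 1) + of_nat (2 * n - 1) * f (length x + 1))"
proof -
  let ?L = "letters (enat n)"
  have fin: "finite ?L" and card: "card ?L = 2 * n"
    by (simp_all add: letters_enat card_cartesian_product)
  have red: "reduced_word x" and sub: "set x \<subseteq> ?L"
    using assms by (auto simp: free_group_def)
  have *: "(\<Sum>y\<in>neighbours (enat n) x. f (length y)) =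
      (\<Sum>a\<in>?L. f (length (x \<otimes>\<^bsub>free_group (enat n)\<^esub> [a])))"
    unfolding neighbours_def by (subst sum.reindex[OF inj_mult_letter]) simp
  show ?thesis
  proof (cases "x = []")
    case True
    then show ?thesis
      unfolding * by (simp add: mult_letter[of "[]"] card del: of_nat_mult)
  next
    case False
    let ?c = "inv_letter (last x)"
    have c: "?c \<in> ?L"
      using False sub by auto
    have "(\<Sum>a\<in>?L - {?c}. f (length (x \<otimes>\<^bsub>free_group (enat n)\<^esub> [a]))) =
        (\<Sum>a\<in>?L - {?c}. f (length x + 1))"
      by (rule sum.cong) (auto simp: mult_letter[OF red])
    then show ?thesis
      unfolding * sum.remove[OF fin c] using False fin c
      by (simp add: mult_letter[OF red] card card_Diff_singleton)
  qed
qed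

lemma carrier_length:
  assumes "n \<ge> 1"
  shows "\<exists>x\<in>carrier (free_group (enat n)). length x = k"
proof
  have "successively (\<lambda>a b. b \<noteq> inv_letter a) (replicate k (0, True))"
    by (induction k) (auto simp: successively_Cons inv_letter_def)
  then show "replicate k (0, True) \<in> carrier (free_group (enat n))"
    using assms by (auto simp: free_group_def reduced_word_def letters_def)
qed simp

lemma spherical_eq_iff:
  assumes "n \<ge> 1"
  shows "spherical_eq (enat n) s f \<longleftrightarrow>
    f 0 = 1 \<and> f 1 = s \<and>
    (\<forall>k. f (Suc (Suc k)) = (of_nat (2 * n) * s * f (Suc k) - f k) / of_nat (2 * n - 1))"
proof -
  let ?C = "carrier (free_group (enat n))"
  have n0: "(of_nat (2 * n) :: complex) \<noteq> 0" and q0: "(of_nat (2 * n - 1) :: complex) \<noteq> 0"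
    using assms by (simp_all only: of_nat_eq_0_iff)
  define P where "P l \<longleftrightarrow> (if l = 0 then f 1 = s * f 0
    else f (l - 1) + of_nat (2 * n - 1) * f (l + 1) = of_nat (2 * n) * s * f l)" for l
  have "(\<Sum>y\<in>neighbours (enat n) x. f (length y)) / of_nat (card (neighbours (enat n) x))
      = s * f (length x) \<longleftrightarrow> P (length x)" if "x \<in> ?C" for x
    unfolding sum_neighbours[OF that assms] card_neighbours[OF that] P_def
    using n0 by (auto simp: divide_eq_eq mult_ac simp del: of_nat_mult)
  then have "spherical_eq (enat n) s f \<longleftrightarrow> f 0 = 1 \<and> (\<forall>x\<in>?C. P (length x))"
    by (simp add: spherical_eq_def)
  also have "(\<forall>x\<in>?C. P (length x)) \<longleftrightarrow> (\<forall>l. P l)"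
    using carrier_length[OF assms] by metis
  also have "(\<forall>l. P l) \<longleftrightarrow> P 0 \<and> (\<forall>k. P (Suc k))"
    by (metis not0_implies_Suc)
  also have "(\<forall>k. P (Suc k)) \<longleftrightarrow>
      (\<forall>k. f (Suc (Suc k)) = (of_nat (2 * n) * s * f (Suc k) - f k) / of_nat (2 * n - 1))"
    unfolding P_def using q0
    by (intro all_cong1) (auto simp: eq_divide_eq algebra_simps simp del: of_nat_mult)
  finally show ?thesis
    by (auto simp: P_def)
qed

fun spherical_rec :: "nat \<Rightarrow> complex \<Rightarrow> nat \<Rightarrow> complex" where
  "spherical_rec n s 0 = 1"
| "spherical_rec n s (Suc 0) = s"
| "spherical_rec n s (Suc (Suc k)) =
     (of_nat (2 * n) * s * spherical_rec n s (Suc k) - spherical_rec n s k) / of_nat (2 * n - 1)"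

lemma spherical_eq_unique:
  assumes "n \<ge> 1"
  shows "spherical_eq (enat n) s f \<longleftrightarrow> f = spherical_rec n s"
proof
  assume f: "spherical_eq (enat n) s f"
  have "f k = spherical_rec n s k" for k
    using f unfolding spherical_eq_iff[OF assms]
    by (induction n s k rule: spherical_rec.induct) simp_all
  then show "f = spherical_rec n s"
    by blast
qed (simp add: spherical_eq_iff[OF assms])

lemma ex1_spherical_eq: "n \<ge> 1 \<Longrightarrow> \<exists>!f. spherical_eq (enat n) s f"
  by (simp add: spherical_eq_unique)

lemma spherical_dot_enat: "n \<ge> 1 \<Longrightarrow> spherical_dot (enat n) s = spherical_rec n s"
  by (auto simp: spherical_dot_def spherical_eq_unique)

end

theory Submission
  imports Defs "HOL-Probability.Probability"
begin

text \<open>Put \<open>t = 1 / (2 r - 1)\<close>, with \<open>t = 0\<close> for infinite rank, and write \<open>A\<close> for the averaging operator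
  over neighbours, acting on profiles of radial functions.  Since \<open>(A - 1) \<psi>\<^sub>s = \<phi>\<^sub>s\<close>, a measure \<open>\<nu>\<close>
  represents a profile \<open>u\<close> with \<open>u 0 = 0\<close> if and only if its moments are the numbers
  \<open>(A ^ i (A - 1) u) 0\<close>.  Testing conditional negativity on functions \<open>p(\<mu>)\<close> with \<open>p(1) = 0\<close>, where \<open>\<mu>\<close> is the
  uniform measure on the letters, and on differences of left translates of \<open>p(\<mu>)\<close> by products of two letters, shows that
  the corresponding moment functional is nonnegative on \<open>(1 - X) q\<^sup>2\<close> and \<open>(1 + X) q\<^sup>2\<close>, hence on all
  Bernstein polynomials of odd degree on \<open>[-1, 1]\<close>; the measure is then a weak limit of
  the discrete measures given by the Bernstein weights.  For infinite rank, positivity is inherited from the subgroups of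
  finite rank by letting \<open>t \<rightarrow> 0\<close>.

  Conversely, spherical functions with eigenvalue in \<open>[-1, 1]\<close> are positive definite, by induction over
  balls of the Cayley tree, so each \<open>\<psi>\<^sub>s\<close> and every mixture of them is conditionally negative definite.\<close>

section \<open>Spherical profiles\<close>

text \<open>The recurrence of the spherical profile with \<open>t\<close> = 1/q; at
  \<open>t = 0\<close> it yields \<open>s ^ n\<close>, so finite and infinite rank share one
  definition.\<close>

fun sph :: "'a::field \<Rightarrow> 'a \<Rightarrow> nat \<Rightarrow> 'a" where
  "sph t s 0 = 1"
| "sph t s (Suc 0) = s"
| "sph t s (Suc (Suc n)) = (1 + t) * s * sph t s (Suc n) - t * sph t s n"

text \<open>The quotient of \<open>1 - sph t s n\<close> by \<open>1 - s\<close> as a polynomial in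
  \<open>s\<close>; its value at \<open>s = 1\<close> is the limit that defines psi_1.\<close>

fun sph_quot :: "'a::field \<Rightarrow> 'a \<Rightarrow> nat \<Rightarrow> 'a" where
  "sph_quot t s 0 = 0"
| "sph_quot t s (Suc 0) = 1"
| "sph_quot t s (Suc (Suc n)) = (1 + t) * (s * sph_quot t s (Suc n) + 1) - t * sph_quot t s n"

lemma sph_quot: "(1 - s) * sph_quot t s n = 1 - sph t s n"
proof (induction t s n rule: sph_quot.induct)
  case (3 t s n)
  have "(1 - s) * sph_quot t s (Suc (Suc n)) =
      (1 + t) * (s * ((1 - s) * sph_quot t s (Suc n)) + (1 - s)) - t * ((1 - s) * sph_quot t s n)"
    by (simp add: algebra_simps)
  also have "\<dots> = 1 - sph t s (Suc (Suc n))"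
    unfolding 3 by (simp add: algebra_simps)
  finally show ?case .
qed simp_all

text \<open>Trading the explicit factor \<open>s\<close> for \<open>sph\<close> makes the recurrence
  integrable term by term. It expresses that averaging minus the identity sends psi_s to
  phi_s.\<close>

lemma sph_quot_Suc:
  "sph_quot t s (Suc (Suc n)) = (1 + t) * (sph_quot t s (Suc n) + sph t s (Suc n)) - t * sph_quot t s n"
proof -
  have "sph t s (Suc n) = 1 - (1 - s) * sph_quot t s (Suc n)"
    using sph_quot[of s t "Suc n"] by simp
  then show ?thesis
    by (simp add: algebra_simps)
qed

lemma of_real_sph_quot:
  "of_real (sph_quot t s n) = (sph_quot (of_real t) (of_real s) n :: 'a::{real_div_algebra,field})"
  by (induction t s n rule: sph_quot.induct) simp_all

lemma continuous_on_sph: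
  fixes f g :: "'b::topological_space \<Rightarrow> 'a::real_normed_field"
  assumes "continuous_on S f" "continuous_on S g"
  shows "continuous_on S (\<lambda>x. sph (f x) (g x) n)"
  by (induction n rule: induct_nat_012) (use assms in \<open>auto intro!: continuous_intros\<close>)

lemma continuous_on_sph_quot:
  fixes f g :: "'b::topological_space \<Rightarrow> 'a::real_normed_field"
  assumes "continuous_on S f" "continuous_on S g"
  shows "continuous_on S (\<lambda>x. sph_quot (f x) (g x) n)"
  by (induction n rule: induct_nat_012) (use assms in \<open>auto intro!: continuous_intros\<close>)

text \<open>The parameter \<open>t\<close> above is the inverse of \<open>q = 2 r - 1\<close>; it is \<open>0\<close> for infinite rank.\<close>

definition inv_branching :: "enat \<Rightarrow> real" where
  "inv_branching r = (case r of enat m \<Rightarrow> 1 / real (2 * m - 1) | \<infinity> \<Rightarrow> 0)"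

lemma inv_branching_nonneg: "0 \<le> inv_branching r"
  by (simp add: inv_branching_def split: enat.split)

lemma spherical_dot_eq:
  assumes "1 \<le> r"
  shows "spherical_dot r s = sph (of_real (inv_branching r)) s"
proof (cases r)
  case (enat m)
  then have m: "m \<ge> 1"
    using assms by (simp add: one_enat_def)
  define q :: complex where "q = of_nat (2 * m - 1)"
  have q: "q \<noteq> 0"
    unfolding q_def of_nat_eq_0_iff using m by simp
  have 2: "of_nat (2 * m) = q + 1"
    using m by (simp add: q_def of_nat_diff)
  have t: "of_real (inv_branching r) = 1 / q"
    by (simp add: enat inv_branching_def q_def)
  have "spherical_rec m s n = sph (of_real (inv_branching r)) s n" for n
  proof (induction n rule: induct_nat_012)
    case (ge2 n)
    then show ?case
      unfolding spherical_rec.simps sph.simps t 2 q_def[symmetric] using q by (simp add: field_simps)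
  qed simp_all
  then show ?thesis
    using m by (auto simp: enat spherical_dot_enat)
next
  case infinity
  have "sph 0 s n = s ^ n" for n
    by (induction n rule: induct_nat_012) simp_all
  then show ?thesis
    by (auto simp: infinity spherical_dot_def inv_branching_def)
qed

text \<open>Off 1 the quotient equals the polynomial \<open>sph_quot\<close>, whose continuity
  identifies the limit at 1.\<close>

lemma psi_sph_eq:
  assumes "1 \<le> r"
  shows "psi_sph r s x = sph_quot (of_real (inv_branching r)) s (length x)"
proof -
  let ?w = "\<lambda>z. sph_quot (of_real (inv_branching r)) z (length x) :: complex"
  have *: "(1 - spherical r z x) / (1 - z) = ?w z" if "z \<noteq> 1" for z
    using sph_quot[of z "of_real (inv_branching r)" "length x"] that
    by (simp add: spherical_def spherical_dot_eq[OF assms] field_simps)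
  have "continuous_on UNIV ?w"
    by (intro continuous_on_sph_quot continuous_intros)
  then have "?w \<midarrow>1\<rightarrow> ?w 1"
    by (auto simp: continuous_on_def)
  then have "((\<lambda>z. (1 - spherical r z x) / (1 - z)) \<longlongrightarrow> ?w 1) (at 1)"
    by (rule Lim_transform_eventually) (auto simp: * eventually_at_filter)
  then have "Lim (at 1) (\<lambda>z. (1 - spherical r z x) / (1 - z)) = ?w 1"
    by (intro tendsto_Lim) auto
  then show ?thesis
    using * by (auto simp: psi_sph_def)
qed

section \<open>Positive definiteness of spherical functions\<close>

definition psd_on :: "'a set \<Rightarrow> ('a \<Rightarrow> 'a \<Rightarrow> real) \<Rightarrow> bool" where
  "psd_on A K \<longleftrightarrow> (\<forall>f. 0 \<le> (\<Sum>x\<in>A. \<Sum>y\<in>A. f x * f y * K x y))"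

text \<open>A Schur complement argument: on \<open>B\<close> the rows of \<open>K\<close> at
  \<open>S\<close> are combinations of rows from \<open>B\<close>, so eliminating \<open>B\<close>
  leaves the corrected kernel on \<open>S\<close>.\<close>

lemma psd_on_extend:
  assumes fin: "finite B" "finite S" and disj: "B \<inter> S = {}"
    and sym: "\<And>x y. K x y = K y x"
    and c: "\<And>v y. v \<in> S \<Longrightarrow> y \<in> B \<Longrightarrow> K v y = (\<Sum>x\<in>B. c v x * K x y)"
    and B: "psd_on B K"
    and S: "psd_on S (\<lambda>v w. K v w - (\<Sum>x\<in>B. c v x * K x w))"
  shows "psd_on (B \<union> S) K"
  unfolding psd_on_def
proof
  fix f
  \<comment> \<open>The mass at each \<open>v\<close> in \<open>S\<close> is moved into
    \<open>B\<close> with coefficients \<open>c v\<close>; the form of \<open>f\<close> is then the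
    form of \<open>g\<close> on \<open>B\<close> plus the Schur complement form on
    \<open>S\<close>.\<close>
  define g where "g x = f x + (\<Sum>v\<in>S. f v * c v x)" for x
  define G where "G v w = (\<Sum>x\<in>B. c v x * K x w)" for v w
  define X where "X = (\<Sum>v\<in>S. \<Sum>y\<in>B. f v * f y * K v y)"
  have 1: "(\<Sum>x\<in>B. g x * K x y) = (\<Sum>x\<in>B. f x * K x y) + (\<Sum>v\<in>S. f v * G v y)" for y
    by (simp add: g_def G_def algebra_simps sum.distrib sum_distrib_left sum_distrib_right
        sum.swap[of _ S B])
  have 2: "(\<Sum>x\<in>B. g x * K x y) = (\<Sum>x\<in>B. f x * K x y) + (\<Sum>v\<in>S. f v * K v y)" if "y \<in> B" for y
    unfolding 1 using c that by (simp add: G_def)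
  have swap: "(\<Sum>y\<in>B. g y * (\<Sum>x\<in>A. f x * K x y)) = (\<Sum>x\<in>A. f x * (\<Sum>y\<in>B. g y * K y x))" for A
    unfolding sum_distrib_left by (subst sum.swap, intro sum.cong refl) (simp add: sym mult.left_commute)
  have "(\<Sum>x\<in>B. \<Sum>y\<in>B. g x * g y * K x y) = (\<Sum>y\<in>B. g y * (\<Sum>x\<in>B. g x * K x y))"
    by (subst sum.swap) (simp add: sum_distrib_left mult_ac)
  also have "\<dots> = (\<Sum>y\<in>B. g y * ((\<Sum>x\<in>B. f x * K x y) + (\<Sum>v\<in>S. f v * K v y)))"
    using 2 by simp
  also have "\<dots> = (\<Sum>x\<in>B. f x * (\<Sum>y\<in>B. g y * K y x)) + (\<Sum>v\<in>S. f v * (\<Sum>y\<in>B. g y * K y v))"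
    by (simp only: distrib_left sum.distrib swap)
  also have "(\<Sum>v\<in>S. f v * (\<Sum>y\<in>B. g y * K y v)) =
      (\<Sum>v\<in>S. f v * (\<Sum>y\<in>B. f y * K y v)) + (\<Sum>v\<in>S. \<Sum>w\<in>S. f v * f w * G w v)"
    unfolding 1 by (simp add: algebra_simps sum.distrib sum_distrib_left)
  also have "(\<Sum>v\<in>S. f v * (\<Sum>y\<in>B. f y * K y v)) = X"
    by (simp add: X_def sum_distrib_left mult_ac sym)
  also have "(\<Sum>x\<in>B. f x * (\<Sum>y\<in>B. g y * K y x)) = (\<Sum>x\<in>B. \<Sum>y\<in>B. f x * f y * K x y) + X"
    using 2 by (simp add: X_def algebra_simps sum.distrib sum_distrib_left sym sum.swap[of _ S B])
  also have "(\<Sum>v\<in>S. \<Sum>w\<in>S. f v * f w * G w v) = (\<Sum>v\<in>S. \<Sum>w\<in>S. f v * f w * G v w)"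
    by (subst sum.swap) (simp add: mult_ac)
  finally have "(\<Sum>x\<in>B. \<Sum>y\<in>B. f x * f y * K x y) + 2 * X =
      (\<Sum>x\<in>B. \<Sum>y\<in>B. g x * g y * K x y) - (\<Sum>v\<in>S. \<Sum>w\<in>S. f v * f w * G v w)"
    by simp
  moreover have "0 \<le> (\<Sum>x\<in>B. \<Sum>y\<in>B. g x * g y * K x y)"
    using B by (simp add: psd_on_def)
  moreover have "0 \<le> (\<Sum>v\<in>S. \<Sum>w\<in>S. f v * f w * K v w) - (\<Sum>v\<in>S. \<Sum>w\<in>S. f v * f w * G v w)"
    using S[unfolded psd_on_def, rule_format, of f]
    by (simp add: G_def right_diff_distrib sum_subtractf)
  moreover have "(\<Sum>x\<in>B \<union> S. \<Sum>y\<in>B \<union> S. f x * f y * K x y) =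
      (\<Sum>x\<in>B. \<Sum>y\<in>B. f x * f y * K x y) + 2 * X + (\<Sum>v\<in>S. \<Sum>w\<in>S. f v * f w * K v w)"
  proof -
    have "(\<Sum>x\<in>B. \<Sum>y\<in>S. f x * f y * K x y) = X"
      unfolding X_def by (subst sum.swap) (simp add: mult_ac sym)
    then show ?thesis
      by (simp add: sum.union_disjoint[OF fin disj] sum.distrib X_def)
  qed
  ultimately show "0 \<le> (\<Sum>x\<in>B \<union> S. \<Sum>y\<in>B \<union> S. f x * f y * K x y)"
    by linarith
qed

text \<open>On each fibre of \<open>p\<close> the matrix is \<open>D\<close> times the identity
  minus \<open>t\<close> times the all-ones matrix, and the largest eigenvalue of the latter is the
  size of the fibre.\<close>

lemma psd_on_fibres:
  fixes t D :: real
  assumes "finite S" "0 \<le> t"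
    and card: "\<And>v. v \<in> S \<Longrightarrow> t * card {w \<in> S. p w = p v} \<le> D"
  shows "psd_on S (\<lambda>v w. if p v = p w then (if v = w then D else 0) - t else 0)"
  unfolding psd_on_def
proof
  fix f :: "'a \<Rightarrow> real"
  define F where "F v = {w \<in> S. p v = p w}" for v
  have fin: "finite (F v)" for v
    using assms by (simp add: F_def)
  let ?b = "\<lambda>v w. of_bool (p v = p w) :: real"
  have count: "(\<Sum>w\<in>S. ?b v w * (f v)\<^sup>2) = card {w \<in> S. p w = p v} * (f v)\<^sup>2" for v
  proof -
    have "(\<Sum>w\<in>S. ?b v w) = card {w \<in> S. p w = p v}"
      using sum.inter_filter[OF assms(1), of "\<lambda>_. 1 :: real" "\<lambda>w. p w = p v"]
      by (simp add: of_bool_def eq_commute[of "p v"])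
    then show ?thesis
      by (simp flip: sum_distrib_right)
  qed
  have E: "f v * f w * (if p v = p w then (if v = w then D else 0) - t else 0) =
      (if v = w then D * (f v)\<^sup>2 else 0) - t * (?b v w * (f v * f w))" for v w
    by (auto simp: algebra_simps power2_eq_square)
  \<comment> \<open>The arithmetic-geometric mean inequality within a fibre takes the place of the
    eigenvalue estimate.\<close>
  have "(\<Sum>v\<in>S. \<Sum>w\<in>S. ?b v w * (f v * f w)) \<le> (\<Sum>v\<in>S. \<Sum>w\<in>S. ?b v w * (((f v)\<^sup>2 + (f w)\<^sup>2) / 2))"
  proof (intro sum_mono mult_left_mono)
    show "f v * f w \<le> ((f v)\<^sup>2 + (f w)\<^sup>2) / 2" for v w
      using sum_squares_bound[of "f v" "f w"] by simp
  qed simp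
  also have "\<dots> = (\<Sum>v\<in>S. \<Sum>w\<in>S. ?b v w * (f v)\<^sup>2 / 2) + (\<Sum>v\<in>S. \<Sum>w\<in>S. ?b v w * (f w)\<^sup>2 / 2)"
    by (simp add: sum.distrib[symmetric] field_simps)
  also have "(\<Sum>v\<in>S. \<Sum>w\<in>S. ?b v w * (f w)\<^sup>2 / 2) = (\<Sum>v\<in>S. \<Sum>w\<in>S. ?b v w * (f v)\<^sup>2 / 2)"
    by (subst sum.swap) (simp add: eq_commute)
  finally have "(\<Sum>v\<in>S. \<Sum>w\<in>S. ?b v w * (f v * f w)) \<le> (\<Sum>v\<in>S. \<Sum>w\<in>S. ?b v w * (f v)\<^sup>2)"
    by (simp flip: sum_divide_distrib)
  also have "\<dots> = (\<Sum>v\<in>S. card {w \<in> S. p w = p v} * (f v)\<^sup>2)"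
    unfolding count ..
  finally have "t * (\<Sum>v\<in>S. \<Sum>w\<in>S. ?b v w * (f v * f w)) \<le>
      t * (\<Sum>v\<in>S. card {w \<in> S. p w = p v} * (f v)\<^sup>2)"
    by (rule mult_left_mono) fact
  also have "\<dots> \<le> (\<Sum>v\<in>S. D * (f v)\<^sup>2)"
    unfolding sum_distrib_left mult.assoc[symmetric] by (intro sum_mono mult_right_mono card) auto
  finally show "0 \<le> (\<Sum>v\<in>S. \<Sum>w\<in>S. f v * f w * (if p v = p w then (if v = w then D else 0) - t else 0))"
    using assms(1) unfolding E sum_subtractf sum_distrib_left[symmetric] by (simp add: sum_distrib_left)
qed

lemma psd_on_cmult: "0 \<le> C \<Longrightarrow> psd_on A K \<Longrightarrow> psd_on A (\<lambda>x y. C * K x y)"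
  unfolding psd_on_def by (simp add: mult.left_commute[of _ C] flip: sum_distrib_left)

section \<open>The left-invariant word metric\<close>

definition fdist :: "fword \<Rightarrow> fword \<Rightarrow> nat" where
  "fdist x y = length (foldr cancel_Cons (rev (map inv_letter y)) x)"

text \<open>Cancellation in the product of the inverse of \<open>y\<close> with \<open>u\<close>
  reaches the last letter of \<open>u\<close> only if all of \<open>u\<close> is a prefix of
  \<open>y\<close>.\<close>

lemma last_quotient:
  assumes "reduced_word y" "reduced_word u" "\<nexists>w. y = u @ w"
  shows "foldr cancel_Cons (rev (map inv_letter y)) u \<noteq> [] \<and>
    last (foldr cancel_Cons (rev (map inv_letter y)) u) = last u"
  using assms
proof (induction y arbitrary: u)
  case (Cons h y)
  then obtain k u' where u: "u = k # u'"
    by (cases u) auto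
  show ?case
  proof (cases "k = h")
    case True
    then have "\<nexists>w. y = u' @ w" "u' \<noteq> []"
      using Cons.prems(3) by (auto simp: u)
    moreover have "reduced_word y" "reduced_word u'"
      using Cons.prems by (auto simp: u reduced_Cons)
    ultimately show ?thesis
      using Cons.IH[of u'] by (simp add: u True)
  next
    case False
    have "reduced_word (rev (map inv_letter y) @ [inv_letter h])"
      using Cons.prems(1) reduced_rev_inv[of "h # y"] by simp
    then have "reduced_word ((rev (map inv_letter y) @ [inv_letter h]) @ u)"
      using Cons.prems(2) False by (subst reduced_append) (simp add: u)
    then have "reduced_word (rev (map inv_letter (h # y)) @ u)"
      by simp
    then show ?thesis
      by (subst (1 2) foldr_reduced) (simp_all add: u)
  qed
qed auto

lemma inv_free_group:
  assumes "x \<in> carrier (free_group r)"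
  shows "inv\<^bsub>free_group r\<^esub> x = rev (map inv_letter x)"
proof -
  interpret group "free_group r"
    by (rule group_free_group)
  show ?thesis
    using assms foldr_left_inv[of "[]" x] foldr_reduced[of x "[]"]
    by (intro inv_equality) (auto simp: free_group_def reduced_rev_inv)
qed

lemma fdist_eq:
  "y \<in> carrier (free_group r) \<Longrightarrow> fdist x y = length (inv\<^bsub>free_group r\<^esub> y \<otimes>\<^bsub>free_group r\<^esub> x)"
  by (simp add: fdist_def inv_free_group) (simp add: free_group_def)

lemma fdist_commute:
  assumes "reduced_word x" "reduced_word y"
  shows "fdist x y = fdist y x"
proof -
  \<comment> \<open>In infinite rank the carrier consists of all reduced words, so the group laws
    apply to any \<open>x\<close> and \<open>y\<close>.\<close>
  interpret group "free_group \<infinity>"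
    by (rule group_free_group)
  have xy: "x \<in> carrier (free_group \<infinity>)" "y \<in> carrier (free_group \<infinity>)"
    using assms by (auto simp: free_group_def letters_def)
  then have "inv\<^bsub>free_group \<infinity>\<^esub> (inv\<^bsub>free_group \<infinity>\<^esub> y \<otimes>\<^bsub>free_group \<infinity>\<^esub> x) =
      inv\<^bsub>free_group \<infinity>\<^esub> x \<otimes>\<^bsub>free_group \<infinity>\<^esub> y"
    by (simp add: inv_mult_group)
  moreover have "length (inv\<^bsub>free_group \<infinity>\<^esub> z) = length z" if "z \<in> carrier (free_group \<infinity>)" for z
    using that by (simp add: inv_free_group)
  ultimately show ?thesis
    using xy by (metis fdist_eq inv_closed m_closed)
qed

lemma fdist_append:
  assumes "reduced_word (u @ w)"
  shows "fdist (u @ w) (u @ z) = fdist w z"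
proof -
  have "reduced_word w"
    using assms by (simp add: reduced_append)
  from foldr_left_inv[OF this, of u] show ?thesis
    using assms by (simp add: fdist_def foldr_reduced)
qed

lemma fdist_snoc:
  assumes "reduced_word (u @ [a])"
  shows "fdist (u @ [a]) u = 1" "fdist u (u @ [a]) = 1"
    "fdist (u @ [a]) (u @ [b]) = (if a = b then 0 else 2)"
proof -
  have u: "reduced_word u"
    using assms by (simp add: reduced_append)
  show "fdist (u @ [a]) u = 1"
    using fdist_append[OF assms, of "[]"] by (simp add: fdist_def)
  then show "fdist u (u @ [a]) = 1"
    using fdist_commute[OF assms u] by simp
  show "fdist (u @ [a]) (u @ [b]) = (if a = b then 0 else 2)"
    using fdist_append[OF assms, of "[b]"] by (simp add: fdist_def)
qed

lemma fdist_self: "reduced_word u \<Longrightarrow> fdist u u = 0"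
  using fdist_append[of u "[]" "[]"] by (simp add: fdist_def)

text \<open>The words extending \<open>u\<close> form the subtree below \<open>u\<close>. From a
  point \<open>y\<close> outside it, the path to a child of \<open>u\<close> passes through the
  parent of \<open>u\<close> and then \<open>u\<close>.\<close>

lemma fdist_snoc_not_prefix:
  assumes "reduced_word (u @ [a])" "reduced_word y" "\<nexists>w. y = u @ w"
  shows "fdist (u @ [a]) y = fdist u y + 1" and "fdist (butlast u) y + 1 = fdist u y"
proof -
  define z where "z = foldr cancel_Cons (rev (map inv_letter y)) u"
  have u: "reduced_word u"
    using assms by (simp add: reduced_append)
  have z: "z \<noteq> []" "last z = last u" "reduced_word z"
    using last_quotient[OF assms(2) u assms(3)] u by (auto simp: z_def reduced_foldr)
  have un: "u \<noteq> []"
    using assms(3) by auto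
  \<comment> \<open>\<open>z\<close> and \<open>u\<close> end in the same letter, so right
    multiplication by a letter cancels in both or in neither.\<close>
  have *: "foldr cancel_Cons (rev (map inv_letter y)) (foldr cancel_Cons u [c]) =
      (if c = inv_letter (last u) then butlast z else z @ [c])" for c
  proof -
    have "foldr cancel_Cons (rev (map inv_letter y)) (foldr cancel_Cons u [c]) = foldr cancel_Cons z [c]"
      by (simp add: z_def foldr_assoc reduced_Cons)
    then show ?thesis
      using mult_letter[OF z(3), where a = c and r = \<infinity>] z by (simp add: free_group_def)
  qed
  have "a \<noteq> inv_letter (last u)"
    using assms(1) un by (simp add: reduced_append)
  then show "fdist (u @ [a]) y = fdist u y + 1"
    using *[of a] assms(1) by (simp add: fdist_def foldr_reduced z_def)
  have "foldr cancel_Cons u [inv_letter (last u)] = butlast u"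
    using mult_letter[OF u, where a = "inv_letter (last u)" and r = \<infinity>] un by (simp add: free_group_def)
  then show "fdist (butlast u) y + 1 = fdist u y"
    using *[of "inv_letter (last u)"] z by (simp add: fdist_def z_def)
qed

section \<open>Balls of the Cayley tree\<close>

definition ball_words :: "nat \<Rightarrow> nat \<Rightarrow> fword set" where
  "ball_words m n = {w. reduced_word w \<and> set w \<subseteq> letters (enat m) \<and> length w \<le> n}"

lemma finite_letters: "finite (letters (enat m))" and card_letters: "card (letters (enat m)) = 2 * m"
  by (simp_all add: letters_enat card_cartesian_product)

lemma finite_ball_words: "finite (ball_words m n)"
  by (rule finite_subset[OF _ finite_lists_length_le[OF finite_letters, of m n]])
    (auto simp: ball_words_def)

text \<open>The three-term recurrence along the path from child through parent to grandparent. For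
  \<open>y = u\<close> and \<open>u\<close> nonempty, child and grandparent both have distance 1
  from \<open>y\<close>, and \<open>s = (1 + t) * s - t * s\<close>; the root has no
  grandparent.\<close>

lemma sph_kernel_step:
  fixes t s :: real
  assumes "reduced_word (u @ [a])" "reduced_word y" "y = u \<or> (\<nexists>w. y = u @ w)"
  shows "sph t s (fdist (u @ [a]) y) =
    (if u = [] then s else (1 + t) * s) * sph t s (fdist u y) -
    (if u = [] then 0 else t) * sph t s (fdist (butlast u) y)"
proof (cases "y = u")
  case True
  have "fdist (butlast u) u = 1" if "u \<noteq> []"
    using that fdist_snoc(2)[of "butlast u" "last u"] assms(1) by (simp add: reduced_append)
  then show ?thesis
    using True fdist_snoc(1)[OF assms(1)] fdist_self[OF assms(2)] by (auto simp: algebra_simps)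
next
  case False
  then have *: "\<nexists>w. y = u @ w" and u: "u \<noteq> []"
    using assms(3) by auto
  have "fdist (u @ [a]) y = Suc (Suc (fdist (butlast u) y))"
    "fdist u y = Suc (fdist (butlast u) y)"
    using fdist_snoc_not_prefix[OF assms(1,2) *] by auto
  then show ?thesis
    using u by simp
qed

lemma psd_on_cong: "psd_on A K \<longleftrightarrow> psd_on A K'" if "\<And>x y. x \<in> A \<Longrightarrow> y \<in> A \<Longrightarrow> K x y = K' x y"
  using that by (simp add: psd_on_def cong: sum.cong)

text \<open>Enlarging a ball by one sphere: the values \<open>K v\<close> at a new vertex \<open>v\<close> are determined on the
  smaller ball by the parent and grandparent of \<open>v\<close>, and the Schur complement
  couples only vertices with the same parent.\<close>

lemma psd_on_ball_words:
  fixes t s :: real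
  assumes "0 \<le> t" "t * real (2 * m - 1) \<le> 1" "m \<ge> 1" "\<bar>s\<bar> \<le> 1"
  shows "psd_on (ball_words m n) (\<lambda>x y. sph t s (fdist x y))"
proof (induction n)
  case 0
  have "ball_words m 0 = {[]}"
    by (auto simp: ball_words_def)
  then show ?case
    by (simp add: psd_on_def fdist_def)
next
  case (Suc n)
  define S where "S = {w. reduced_word w \<and> set w \<subseteq> letters (enat m) \<and> length w = Suc n}"
  define K where "K x y = sph t s (fdist x y)" for x y
  \<comment> \<open>The kernel is cut off outside reduced words because \<open>psd_on_extend\<close>
    asks for symmetry at all arguments.\<close>
  define K' where "K' x y = (if reduced_word x \<and> reduced_word y then K x y else 0)" for x y
  \<comment> \<open>The coefficients from \<open>sph_kernel_step\<close>. For \<open>n = 0\<close>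
    parent and grandparent are both \<open>[]\<close>, and \<beta> = 0 removes the second.\<close>
  define \<alpha> where "\<alpha> = (if n = 0 then s else (1 + t) * s)"
  define \<beta> where "\<beta> = (if n = 0 then 0 else t)"
  define c where "c v x = (if x = butlast v then \<alpha> else 0) - (if x = butlast (butlast v) then \<beta> else 0)"
    for v x :: fword
  \<comment> \<open>Among siblings the Schur complement is \<open>C\<close> times the matrix of
    \<open>psd_on_fibres\<close>; \<open>D\<close> is larger at the root, which has one child more
    than other vertices.\<close>
  define C where "C = (if n = 0 then 1 - s\<^sup>2 else (1 + t) * (1 - s\<^sup>2))"
  define D where "D = (if n = 0 then 1 + t else 1)"
  let ?B = "ball_words m n"
  have s2: "s\<^sup>2 \<le> 1"
    using assms(4) by (simp add: abs_square_le_1)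
  have split: "ball_words m (Suc n) = ?B \<union> S" and disj: "?B \<inter> S = {}"
    by (auto simp: ball_words_def S_def)
  have "finite (ball_words m (Suc n))"
    by (rule finite_ball_words)
  then have fin: "finite ?B" "finite S"
    by (simp_all add: split)
  have S: "\<exists>u a. v = u @ [a] \<and> length u = n \<and> u \<in> ?B \<and> butlast u \<in> ?B" if v: "v \<in> S" for v
  proof -
    obtain u a where va: "v = u @ [a]"
      using v by (cases v rule: rev_cases) (auto simp: S_def)
    moreover have "reduced_word (butlast u)"
      using v va by (cases u rule: rev_cases) (auto simp: S_def reduced_append)
    ultimately show ?thesis
      using v by (auto simp: S_def ball_words_def reduced_append dest: in_set_butlastD)
  qed
  have red: "reduced_word v" if "v \<in> ?B \<union> S" for v
    using that by (auto simp: S_def ball_words_def)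
  have sum_c: "(\<Sum>x\<in>?B. c v x * K' x y) = \<alpha> * K (butlast v) y - \<beta> * K (butlast (butlast v)) y"
    if "v \<in> S" "reduced_word y" for v y
  proof -
    have "butlast v \<in> ?B" "butlast (butlast v) \<in> ?B"
      using S[OF that(1)] by auto
    moreover have *: "c v x * K' x y = (if x = butlast v then \<alpha> * K' x y else 0) -
        (if x = butlast (butlast v) then \<beta> * K' x y else 0)" for x
      by (auto simp: c_def algebra_simps)
    ultimately have "(\<Sum>x\<in>?B. c v x * K' x y) =
        \<alpha> * K' (butlast v) y - \<beta> * K' (butlast (butlast v)) y"
      unfolding * using fin by (simp add: sum_subtractf)
    then show ?thesis
      using S[OF that(1)] that(2) red by (auto simp: K'_def)
  qed
  have step: "K v y = \<alpha> * K (butlast v) y - \<beta> * K (butlast (butlast v)) y"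
    if v: "v \<in> S" and y: "reduced_word y" "y = butlast v \<or> (\<nexists>w. y = butlast v @ w)" for v y
  proof -
    obtain u a where "v = u @ [a]" "length u = n" "reduced_word (u @ [a])"
      using S[OF v] red[of v] v by auto
    with sph_kernel_step[of u a y t s] y show ?thesis
      by (auto simp: K_def \<alpha>_def \<beta>_def)
  qed
  have "psd_on (?B \<union> S) K'"
  proof (rule psd_on_extend[where c = c, OF fin disj])
    show "K' x y = K' y x" for x y
      by (simp add: K'_def K_def fdist_commute)
    show "K' v y = (\<Sum>x\<in>?B. c v x * K' x y)" if "v \<in> S" "y \<in> ?B" for v y
    proof -
      have "y = butlast v \<or> (\<nexists>w. y = butlast v @ w)"
        using S[OF that(1)] that(2) by (auto simp: ball_words_def)
      then show ?thesis
        using that red step sum_c by (simp add: K'_def)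
    qed
    show "psd_on ?B K'"
      using Suc psd_on_cong[of ?B K' "\<lambda>x y. sph t s (fdist x y)"] red by (simp add: K'_def K_def)
    have G: "K' v w - (\<Sum>x\<in>?B. c v x * K' x w) =
        C * (if butlast v = butlast w then (if v = w then D else 0) - t else 0)"
      if v: "v \<in> S" and w: "w \<in> S" for v w
    proof -
      have rw: "reduced_word v" "reduced_word w"
        using v w red by auto
      then have eq: "K' v w - (\<Sum>x\<in>?B. c v x * K' x w) =
          K v w - \<alpha> * K (butlast v) w + \<beta> * K (butlast (butlast v)) w"
        using sum_c[OF v] by (simp add: K'_def)
      obtain u a where va: "v = u @ [a]" "length u = n"
        using S[OF v] by auto
      obtain u' b where wb: "w = u' @ [b]" "length u' = n"
        using S[OF w] by auto
      show ?thesis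
      proof (cases "u = u'")
        case False
        \<comment> \<open>Words of equal length with different parents: \<open>w\<close> is not
          below the parent of \<open>v\<close>, so the correction cancels the entry.\<close>
        then have "\<nexists>z. w = butlast v @ z"
          using va wb by auto
        then show ?thesis
          using step[OF v rw(2)] False va wb unfolding eq by simp
      next
        case True
        have 1: "K u w = s"
          using fdist_snoc(2)[of u b] rw True by (simp add: wb K_def)
        have 2: "sph t s 2 = (1 + t) * s\<^sup>2 - t"
          by (simp add: numeral_2_eq_2 power2_eq_square)
        have 3: "K (butlast u) w = sph t s 2" if "u \<noteq> []"
        proof -
          obtain p c where p: "u = p @ [c]"
            using \<open>u \<noteq> []\<close> by (cases u rule: rev_cases) auto
          have rp: "reduced_word (p @ [c, b])"
            using rw(2) unfolding wb True[symmetric] p by simp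
          then have "fdist (p @ [c, b]) (p @ []) = fdist [c, b] []"
            by (rule fdist_append)
          moreover have "reduced_word p"
            using rp by (simp add: reduced_append)
          ultimately have "fdist p (p @ [c, b]) = 2"
            using fdist_commute[OF rp, of p] by (simp add: fdist_def)
          moreover have "butlast u = p" "w = p @ [c, b]"
            unfolding wb True[symmetric] p by simp_all
          ultimately show ?thesis
            by (simp add: K_def)
        qed
        have 4: "K v w = (if a = b then 1 else sph t s 2)"
          using fdist_snoc(3)[of u a b] rw True by (simp add: va wb K_def)
        have 5: "\<beta> * K (butlast u) w = \<beta> * sph t s 2"
          using 3 va by (cases "n = 0") (auto simp: \<beta>_def)
        have 6: "butlast v = u" "butlast w = u" "v = w \<longleftrightarrow> a = b"
          using va wb True by auto
        have "(if a = b then 1 else (1 + t) * s\<^sup>2 - t) - \<alpha> * s + \<beta> * ((1 + t) * s\<^sup>2 - t) =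
            C * ((if a = b then D else 0) - t)"
          by (simp add: C_def D_def \<alpha>_def \<beta>_def algebra_simps power2_eq_square)
        then show ?thesis
          unfolding eq 4 6 1 5 2 by simp
      qed
    qed
    have "psd_on S (\<lambda>v w. if butlast v = butlast w then (if v = w then D else 0) - t else 0)"
    proof (rule psd_on_fibres[OF fin(2) assms(1)])
      fix v assume v: "v \<in> S"
      then obtain u a where va: "v = u @ [a]" "length u = n"
        using S by blast
      \<comment> \<open>The letters that can follow \<open>u\<close> without cancellation: all
        \<open>2 * m\<close> at the root, one fewer elsewhere.\<close>
      define E where "E = letters (enat m) - (if n = 0 then {} else {inv_letter (last u)})"
      have "{w \<in> S. butlast w = butlast v} \<subseteq> (\<lambda>b. u @ [b]) ` E"
      proof
        fix w assume "w \<in> {w \<in> S. butlast w = butlast v}"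
        moreover from this obtain u' b where "w = u' @ [b]"
          using S by blast
        ultimately have "w = u @ [b]" "w \<in> S"
          using va by auto
        then show "w \<in> (\<lambda>b. u @ [b]) ` E"
          using va by (auto simp: E_def S_def reduced_append)
      qed
      then have "card {w \<in> S. butlast w = butlast v} \<le> card E"
        by (rule surj_card_le[rotated]) (simp add: E_def finite_letters)
      also have "card E \<le> (if n = 0 then 2 * m else 2 * m - 1)"
      proof -
        have "inv_letter (last u) \<in> letters (enat m)" if "n \<noteq> 0"
        proof -
          have "last u \<in> set v"
            using that va by auto
          then show ?thesis
            using v by (auto simp: S_def)
        qed
        then show ?thesis
          by (auto simp: E_def card_Diff_singleton card_letters)
      qed
      finally have "t * card {w \<in> S. butlast w = butlast v} \<le> t * (if n = 0 then 2 * m else 2 * m - 1)"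
        using assms(1) by (intro mult_left_mono) (auto simp del: of_nat_mult)
      also have "\<dots> \<le> D"
        using assms(2,3) by (auto simp: D_def algebra_simps of_nat_diff)
      finally show "t * card {w \<in> S. butlast w = butlast v} \<le> D" .
    qed
    then have "psd_on S (\<lambda>v w. C * (if butlast v = butlast w then (if v = w then D else 0) - t else 0))"
      using s2 assms(1) by (intro psd_on_cmult) (auto simp: C_def)
    then show "psd_on S (\<lambda>v w. K' v w - (\<Sum>x\<in>?B. c v x * K' x w))"
      using G by (subst psd_on_cong) auto
  qed
  then show ?case
    using psd_on_cong[of "?B \<union> S" K' "\<lambda>x y. sph t s (fdist x y)"] red by (simp add: split K'_def K_def)
qed

text \<open>The points \<open>x j\<close> may repeat, so the coefficients of equal points are added
  up first.\<close>

lemma psd_on_multiset: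
  fixes n :: nat
  assumes psd: "psd_on B K" and B: "finite B" "\<And>j. j < n \<Longrightarrow> x j \<in> B"
  shows "0 \<le> (\<Sum>j<n. \<Sum>k<n. c j * c k * K (x j) (x k))"
proof -
  define f where "f y = (\<Sum>j<n. if x j = y then c j else 0)" for y
  have sum_f: "(\<Sum>y\<in>B. f y * g y) = (\<Sum>j<n. c j * g (x j))" for g :: "'a \<Rightarrow> real"
  proof -
    have "(\<Sum>y\<in>B. f y * g y) = (\<Sum>j<n. \<Sum>y\<in>B. if x j = y then c j * g y else 0)"
      unfolding f_def sum_distrib_right by (subst sum.swap) (simp add: if_distrib[of "\<lambda>a. a * _"] cong: if_cong)
    then show ?thesis
      using B by simp
  qed
  have "(\<Sum>y\<in>B. \<Sum>z\<in>B. f y * f z * K y z) = (\<Sum>y\<in>B. f y * (\<Sum>z\<in>B. f z * K y z))"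
    by (simp add: sum_distrib_left mult.assoc)
  also have "\<dots> = (\<Sum>y\<in>B. f y * (\<Sum>k<n. c k * K y (x k)))"
    by (simp only: sum_f)
  also have "\<dots> = (\<Sum>j<n. c j * (\<Sum>k<n. c k * K (x j) (x k)))"
    by (rule sum_f)
  also have "\<dots> = (\<Sum>j<n. \<Sum>k<n. c j * c k * K (x j) (x k))"
    by (simp add: sum_distrib_left mult.assoc)
  finally show ?thesis
    using psd[unfolded psd_on_def, rule_format, of f] by simp
qed

lemma sph_positive_definite:
  fixes n :: nat
  assumes r: "1 \<le> r" and s: "\<bar>s\<bar> \<le> 1" and x: "\<And>j. j < n \<Longrightarrow> x j \<in> carrier (free_group r)"
  shows "0 \<le> (\<Sum>j<n. \<Sum>k<n. c j * c k * sph (inv_branching r) s (fdist (x j) (x k)))"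
proof -
  obtain m where m: "1 \<le> m" "inv_branching r * real (2 * m - 1) \<le> 1"
    and xm: "\<And>j. j < n \<Longrightarrow> x j \<in> carrier (free_group (enat m))"
  proof (cases r)
    case (enat m)
    then have "1 \<le> m"
      using r by (simp add: one_enat_def)
    then show ?thesis
      using x by (intro that[of m]) (auto simp: enat inv_branching_def)
  next
    case infinity
    \<comment> \<open>The words involve finitely many generators, and \<open>t = 0\<close> meets the
      bound of \<open>psd_on_ball_words\<close> in every finite rank.\<close>
    have "finite (\<Union>j<n. fst ` set (x j))"
      by (intro finite_UN_I finite_imageI) auto
    then obtain b where b: "\<forall>i\<in>(\<Union>j<n. fst ` set (x j)). i < b"
      unfolding finite_nat_set_iff_bounded by blast
    show ?thesis
    proof (rule that[of "Suc b"])
      show "x j \<in> carrier (free_group (enat (Suc b)))" if "j < n" for j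
        using x[OF that] b that by (force simp: free_group_def letters_def less_Suc_eq)
    qed (simp_all add: infinity inv_branching_def)
  qed
  have "psd_on (ball_words m (\<Sum>j<n. length (x j))) (\<lambda>y z. sph (inv_branching r) s (fdist y z))"
    using m s inv_branching_nonneg by (intro psd_on_ball_words) auto
  moreover have "x j \<in> ball_words m (\<Sum>j<n. length (x j))" if "j < n" for j
    using xm[OF that] member_le_sum[of j "{..<n}" "\<lambda>j. length (x j)"] that
    by (simp add: ball_words_def free_group_def)
  ultimately show ?thesis
    using psd_on_multiset finite_ball_words by blast
qed

text \<open>For \<open>s < 1\<close>, multiply by \<open>1 - s\<close>: the constant 1 contributes
  the square of the sum of \<open>c\<close>, which is 0, and a positive definite form is subtracted.
  The case \<open>s = 1\<close> is a limit from the left.\<close>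

lemma sph_quot_cond_negative:
  fixes c :: "nat \<Rightarrow> real"
  assumes r: "1 \<le> r" and s: "\<bar>s\<bar> \<le> 1" and x: "\<And>j. j < n \<Longrightarrow> x j \<in> carrier (free_group r)"
    and c: "(\<Sum>j<n. c j) = 0"
  shows "(\<Sum>j<n. \<Sum>k<n. c j * c k * sph_quot (inv_branching r) s (fdist (x j) (x k))) \<le> 0"
proof -
  let ?t = "inv_branching r"
  define Q where "Q s = (\<Sum>j<n. \<Sum>k<n. c j * c k * sph_quot ?t s (fdist (x j) (x k)))" for s
  have Q: "Q s \<le> 0" if "-1 \<le> s" "s < 1" for s
  proof -
    have "(1 - s) * Q s = (\<Sum>j<n. \<Sum>k<n. c j * c k * ((1 - s) * sph_quot ?t s (fdist (x j) (x k))))"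
      by (simp add: Q_def sum_distrib_left mult_ac)
    also have "\<dots> = (\<Sum>j<n. c j) * (\<Sum>k<n. c k) - (\<Sum>j<n. \<Sum>k<n. c j * c k * sph ?t s (fdist (x j) (x k)))"
      by (simp add: sph_quot right_diff_distrib sum_subtractf sum_product)
    also have "\<dots> \<le> 0"
      using sph_positive_definite[where s = s and n = n and c = c, OF r _ x] that c by (simp add: abs_le_iff)
    finally show ?thesis
      using that by (simp add: mult_le_0_iff)
  qed
  have "continuous_on UNIV Q"
    unfolding Q_def by (intro continuous_intros continuous_on_sph_quot)
  then have "(Q \<longlongrightarrow> Q 1) (at_left 1)"
    by (auto simp: continuous_on_def intro: tendsto_within_subset)
  moreover have "\<forall>\<^sub>F s in at_left 1. Q s \<le> 0"
    using Q by (intro eventually_at_leftI[of "-1"]) auto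
  ultimately have "Q 1 \<le> 0"
    by (intro tendsto_upperbound) auto
  then show ?thesis
    using Q[of s] s unfolding Q_def by (cases "s = 1") (auto simp: abs_le_iff)
qed

section \<open>The moment problem on an interval\<close>

text \<open>The Riesz functional of \<open>M\<close>: linear on polynomials, with value
  \<open>M i\<close> at X^i.\<close>

definition moment_functional :: "(nat \<Rightarrow> 'a::comm_semiring_0) \<Rightarrow> 'a poly \<Rightarrow> 'a" where
  "moment_functional M p = (\<Sum>i\<le>degree p. coeff p i * M i)"

lemma moment_functional_le:
  "degree p \<le> n \<Longrightarrow> moment_functional M p = (\<Sum>i\<le>n. coeff p i * M i)"
  unfolding moment_functional_def by (rule sum.mono_neutral_left) (auto simp: coeff_eq_0)

lemma moment_functional_add:
  "moment_functional M (p + q) = moment_functional M p + moment_functional M q"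
  by (subst (1 2 3) moment_functional_le[where n = "max (degree p) (degree q)"])
    (auto simp: degree_add_le algebra_simps sum.distrib)

lemma moment_functional_smult: "moment_functional M (smult c p) = c * moment_functional M p"
  by (subst (1 2) moment_functional_le[where n = "degree p"])
    (auto simp: degree_smult_le sum_distrib_left mult_ac)

lemma moment_functional_0 [simp]: "moment_functional M 0 = 0"
  by (simp add: moment_functional_def)

lemma moment_functional_pCons:
  "moment_functional M (pCons a p) = a * M 0 + moment_functional (\<lambda>i. M (Suc i)) p"
  by (subst moment_functional_le[where n = "Suc (degree p)"])
    (auto simp: degree_pCons_le moment_functional_def sum.atMost_Suc_shift simp del: sum.atMost_Suc)

lemma moment_functional_mult:
  "moment_functional M (p * q) = moment_functional (\<lambda>i. moment_functional (\<lambda>j. M (i + j)) q) p"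
  by (induction p arbitrary: M)
    (simp_all add: moment_functional_pCons moment_functional_add moment_functional_smult)

lemma moment_functional_square:
  "moment_functional M (p * p) =
    (\<Sum>k\<le>degree p. \<Sum>l\<le>degree p. coeff p k * coeff p l * M (k + l))"
  unfolding moment_functional_mult by (simp add: moment_functional_def sum_distrib_left mult_ac)

lemma moment_functional_monom: "moment_functional M (monom a i) = a * M i"
  by (induction i arbitrary: M) (simp_all add: monom_0 monom_Suc moment_functional_pCons)

section \<open>Bernstein expansions and their sampling error\<close>

text \<open>The factorial moments of the binomial distribution, from \<open>(N choose k) * (k choose
  i) = (N choose i) * (N - i choose k - i)\<close>. It is stated over a ring because
  \<open>y\<close> will be the polynomial (1 + X)/2.\<close>

lemma binomial_sum_choose:
  fixes y :: "'a::comm_ring_1"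
  assumes "i \<le> N"
  shows "(\<Sum>k\<le>N. of_nat (N choose k) * of_nat (k choose i) * (y ^ k * (1 - y) ^ (N - k))) =
    of_nat (N choose i) * y ^ i"
proof -
  have "(\<Sum>k\<le>N. of_nat (N choose k) * of_nat (k choose i) * (y ^ k * (1 - y) ^ (N - k))) =
      (\<Sum>k\<in>{i..N}. of_nat ((N choose k) * (k choose i)) * (y ^ k * (1 - y) ^ (N - k)))"
    by (rule sum.mono_neutral_cong_right) (auto simp: binomial_eq_0)
  also have "\<dots> = (\<Sum>j\<le>N - i. of_nat ((N choose (i + j)) * ((i + j) choose i)) * (y ^ (i + j) * (1 - y) ^ (N - (i + j))))"
    by (rule sum.reindex_bij_witness[of _ "\<lambda>j. i + j" "\<lambda>k. k - i"]) (use assms in auto)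
  also have "\<dots> = (\<Sum>j\<le>N - i. of_nat (N choose i) * y ^ i * (of_nat (N - i choose j) * y ^ j * (1 - y) ^ (N - i - j)))"
  proof (rule sum.cong)
    fix j assume "j \<in> {..N - i}"
    then have "(N choose (i + j)) * ((i + j) choose i) = (N choose i) * (N - i choose j)"
      using assms choose_mult[of i "i + j" N] by simp
    then show "of_nat ((N choose (i + j)) * ((i + j) choose i)) * (y ^ (i + j) * (1 - y) ^ (N - (i + j))) =
        of_nat (N choose i) * y ^ i * (of_nat (N - i choose j) * y ^ j * (1 - y) ^ (N - i - j))"
      by (simp add: power_add mult_ac)
  qed simp
  also have "\<dots> = of_nat (N choose i) * y ^ i * (y + (1 - y)) ^ (N - i)"
    unfolding binomial_ring by (simp add: sum_distrib_left)
  finally show ?thesis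
    by simp
qed

text \<open>Compares the Bernstein coefficient of a power with the value of that power at the node
  k/N, uniformly in \<open>k\<close>. Raising \<open>i\<close> by one multiplies the former by (k -
  i)/(N - i), the latter by k/N.\<close>

lemma choose_ratio_power_bound:
  assumes "i < N" "k \<le> N"
  shows "\<bar>real (k choose i) / real (N choose i) - (real k / real N) ^ i\<bar> \<le> (real i)\<^sup>2 / real (N - i)"
  using assms(1)
proof (induction i)
  case (Suc i)
  let ?g = "real (k choose i) / real (N choose i)" and ?y = "real k / real N"
  define a where "a = (real k - real i) / (real N - real i)"
  have N: "i < N" "0 < N"
    using Suc.prems by auto
  have rec: "(real i + 1) * real (n choose Suc i) = (real n - real i) * real (n choose i)" for n
  proof (cases "i \<le> n")
    case True
    then have "Suc i * (n choose Suc i) = (n - i) * (n choose i)"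
      by (simp only: binomial_absorption binomial_absorb_comp)
    then have "real (Suc i * (n choose Suc i)) = real ((n - i) * (n choose i))"
      by (simp only:)
    then show ?thesis
      using True by (simp add: of_nat_diff algebra_simps)
  qed (simp add: binomial_eq_0)
  have "real (k choose Suc i) / real (N choose Suc i) =
      ((real i + 1) * real (k choose Suc i)) / ((real i + 1) * real (N choose Suc i))"
    by simp
  also have "\<dots> = ?g * a"
    unfolding rec by (simp add: a_def mult.commute)
  finally have g: "real (k choose Suc i) / real (N choose Suc i) = ?g * a" .
  have id_ring: "x * a - y * z = x * (a - y) + y * (x - z)" for x y z :: real
    by (simp add: algebra_simps)
  have "k choose i \<le> N choose i"
    using assms by (intro binomial_right_mono) auto
  then have g01: "0 \<le> ?g" "?g \<le> 1"
    using N by (auto simp: divide_le_eq_1 zero_less_binomial)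
  have A1: "\<bar>?g * (a - ?y)\<bar> \<le> real i / real (N - i)"
  \<comment> \<open>For \<open>k < i\<close> the factor \<open>?g\<close> is 0, so
    \<open>a - ?y\<close> has to be bounded for \<open>i\<close> \<le> \<open>k\<close>
    alone.\<close>
  proof (cases "k < i")
    case False
    have "?y - a = real i * (real N - real k) / (real N * (real N - real i))"
      using N by (simp add: a_def field_simps)
    also have "\<dots> = (real i / real (N - i)) * ((real N - real k) / real N)"
      using N by (simp add: of_nat_diff)
    finally have *: "?y - a = (real i / real (N - i)) * ((real N - real k) / real N)" .
    have "0 \<le> (real N - real k) / real N" "(real N - real k) / real N \<le> 1"
      using N assms by auto
    then have "\<bar>a - ?y\<bar> \<le> real i / real (N - i)"
      using * mult_left_mono[of "(real N - real k) / real N" 1 "real i / real (N - i)"]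
      using assms unfolding abs_minus_commute[of a] * abs_mult by simp
    then show ?thesis
      using g01 mult_mono[of "\<bar>?g\<bar>" 1 "\<bar>a - ?y\<bar>" "real i / real (N - i)"] by (simp add: abs_mult)
  qed (simp add: binomial_eq_0)
  have A2: "\<bar>?y * (?g - ?y ^ i)\<bar> \<le> (real i)\<^sup>2 / real (N - i)"
  proof -
    have "\<bar>?y\<bar> \<le> 1"
      using N assms by simp
    then have "\<bar>?y\<bar> * \<bar>?g - ?y ^ i\<bar> \<le> 1 * ((real i)\<^sup>2 / real (N - i))"
      using Suc N by (intro mult_mono) auto
    then show ?thesis
      by (simp only: abs_mult mult_1)
  qed
  have A3: "real (k choose Suc i) / real (N choose Suc i) - ?y ^ Suc i =
      ?g * (a - ?y) + ?y * (?g - ?y ^ i)"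
    unfolding g power_Suc by (rule id_ring)
  have "\<bar>real (k choose Suc i) / real (N choose Suc i) - ?y ^ Suc i\<bar> \<le>
      real i / real (N - i) + (real i)\<^sup>2 / real (N - i)"
    unfolding A3 by (rule order_trans[OF abs_triangle_ineq add_mono[OF A1 A2]])
  also have "\<dots> = (real i + (real i)\<^sup>2) / real (N - i)"
    by (simp add: add_divide_distrib)
  also have "\<dots> \<le> (real (Suc i))\<^sup>2 / real (N - Suc i)"
    using Suc.prems by (intro frac_le) (auto simp: power2_eq_square algebra_simps)
  finally show ?case .
qed simp

text \<open>The powers of (1 + X)/2 span all polynomials.\<close>

lemma poly_functional_eqI:
  fixes L L' :: "real poly \<Rightarrow> real"
  assumes add: "\<And>p q. L (p + q) = L p + L q" "\<And>p q. L' (p + q) = L' p + L' q"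
    and smult: "\<And>c p. L (smult c p) = c * L p" "\<And>c p. L' (smult c p) = c * L' p"
    and eq: "\<And>i. L ([:1/2, 1/2:] ^ i) = L' ([:1/2, 1/2:] ^ i)"
  shows "L p = L' p"
proof -
  let ?Y = "[:1/2, 1/2:] :: real poly"
  \<comment> \<open>Carrying the factor \<open>?Y ^ i\<close> lets the induction on \<open>p\<close>
    trade each X for \<open>2 * ?Y - 1\<close>.\<close>
  have "L (?Y ^ i * p) = L' (?Y ^ i * p)" for i
  proof (induction p arbitrary: i)
    case 0
    then show ?case
      using smult(1)[of 0 0] smult(2)[of 0 0] by simp
  next
    case (pCons a p)
    have X: "[:0, 1:] = smult 2 ?Y + smult (-1) 1"
      by (simp add: one_pCons)
    have "pCons a p = smult a 1 + [:0, 1:] * p"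
      by simp
    then have "?Y ^ i * pCons a p = smult a (?Y ^ i) + (smult 2 (?Y ^ Suc i * p) + smult (-1) (?Y ^ i * p))"
      unfolding X by (simp only: power_Suc algebra_simps mult_smult_left mult_smult_right mult_1_left mult_1_right)
    then show ?case
      by (simp only: add smult eq pCons.IH)
  qed
  from this[of 0] show ?thesis
    by simp
qed

text \<open>Hausdorff's moment problem on [-1, 1]: Bernstein weights at the nodes 2k/N - 1 give
  positive measures of mass \<open>L 1\<close> whose moments approach those of \<open>L\<close>. The
  hypothesis speaks of infinitely many \<open>N\<close> since positivity will be available in odd
  degrees.\<close>

lemma moment_measure_exists:
  fixes L :: "real poly \<Rightarrow> real"
  assumes add: "\<And>p q. L (p + q) = L p + L q"
    and smult: "\<And>c p. L (smult c p) = c * L p"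
    and pos: "\<exists>\<^sub>\<infinity>N. \<forall>k\<le>N. 0 \<le> L ([:1/2, 1/2:] ^ k * [:1/2, -1/2:] ^ (N - k))"
  shows "\<exists>\<nu>. sets \<nu> = sets (restrict_space borel {-1..1::real}) \<and> finite_measure \<nu> \<and>
    (\<forall>p. (LINT s|\<nu>. poly p s) = L p)"
proof -
  let ?Y = "[:1/2, 1/2:] :: real poly"
  have L0: "L 0 = 0"
    using smult[of 0 0] by simp
  have L_sum: "L (\<Sum>k\<in>A. h k) = (\<Sum>k\<in>A. L (h k))" for A :: "nat set" and h
    by (induction A rule: infinite_finite_induct) (auto simp: L0 add)
  define lam where "lam N k = real (N choose k) * L (?Y ^ k * (1 - ?Y) ^ (N - k))" for N k
  have Y1: "1 - ?Y = [:1/2, -1/2:]"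
    by (simp add: one_pCons)
  obtain f where f: "\<And>n. n < f n" and lam_f: "\<And>n k. k \<le> f n \<Longrightarrow> 0 \<le> lam (f n) k"
    using pos unfolding INFM_nat lam_def Y1 by (metis mult_nonneg_nonneg of_nat_0_le_iff)
  \<comment> \<open>Tested against ratios of binomials instead of powers of the nodes, the weights
    reproduce \<open>L (?Y ^ i)\<close> exactly.\<close>
  have moment: "(\<Sum>k\<le>N. lam N k * (real (k choose i) / real (N choose i))) = L (?Y ^ i)" if "i \<le> N" for N i
  proof -
    have "of_nat (N choose i) * ?Y ^ i = smult (real (N choose i)) (?Y ^ i)"
      by (simp add: of_nat_poly)
    then have "real (N choose i) * L (?Y ^ i) = L (of_nat (N choose i) * ?Y ^ i)"
      by (simp only: smult)
    also have "\<dots> = (\<Sum>k\<le>N. L (of_nat (N choose k) * of_nat (k choose i) * (?Y ^ k * (1 - ?Y) ^ (N - k))))"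
      unfolding binomial_sum_choose[OF that, symmetric] L_sum ..
    also have "\<dots> = (\<Sum>k\<le>N. lam N k * real (k choose i))"
    proof (rule sum.cong)
      fix k
      have "of_nat (N choose k) * of_nat (k choose i) * (?Y ^ k * (1 - ?Y) ^ (N - k)) =
          smult (real (N choose k) * real (k choose i)) (?Y ^ k * (1 - ?Y) ^ (N - k))"
        by (simp add: of_nat_poly mult_ac)
      then show "L (of_nat (N choose k) * of_nat (k choose i) * (?Y ^ k * (1 - ?Y) ^ (N - k))) =
          lam N k * real (k choose i)"
        by (simp only: smult lam_def mult_ac)
    qed simp
    finally show ?thesis
      using that zero_less_binomial[of i N] by (simp add: field_simps flip: sum_divide_distrib)
  qed
  define m where "m = L 1"
  have sum_lam: "(\<Sum>k\<le>N. lam N k) = m" for N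
    using moment[of 0 N] by (simp add: m_def)
  have m0: "0 \<le> m"
    using sum_lam[of "f 0"] lam_f[of _ 0] by (auto intro!: sum_nonneg simp flip: sum_lam[of "f 0"])
  \<comment> \<open>Composition with \<open>clamp\<close> makes polynomials bounded and continuous
    on the whole line, as weak convergence requires, without changing them on [-1, 1].\<close>
  define clamp where "clamp x = max (-1) (min 1 x)" for x :: real
  have clamp: "-1 \<le> clamp x" "clamp x \<le> 1" "x \<in> {-1..1} \<Longrightarrow> clamp x = x" for x
    by (auto simp: clamp_def)
  have cont_clamp: "isCont (\<lambda>x. poly p (clamp x)) x" for p x
    unfolding clamp_def by (intro continuous_intros)
  have meas_clamp [measurable]: "(\<lambda>x. poly p (clamp x)) \<in> borel_measurable borel" for p
    by (intro borel_measurable_continuous_onI continuous_at_imp_continuous_on ballI cont_clamp)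
  have bdd_clamp: "\<exists>B. \<forall>x. norm (poly p (clamp x)) \<le> B" for p
  proof -
    have "compact (poly p ` {-1..1})"
      by (intro compact_continuous_image continuous_intros) auto
    then obtain B where "\<forall>y\<in>poly p ` {-1..1}. norm y \<le> B"
      using compact_imp_bounded bounded_iff by blast
    then show ?thesis
      using clamp by (metis atLeastAtMost_iff image_eqI)
  qed
  \<comment> \<open>The weak limit is taken among probability measures, with the mass
    \<open>m\<close> split off.\<close>
  have "\<exists>M. real_distribution M \<and> (AE x in M. x \<in> {-1..1}) \<and> (\<forall>i. m * (LINT x|M. poly (?Y ^ i) (clamp x)) = L (?Y ^ i))"
  proof (cases "m = 0")
    case True
    \<comment> \<open>Mass 0 makes all weights vanish; the Dirac measure at 0 then serves as a
      placeholder.\<close>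
    have "lam (f n) k = 0" if "k \<le> f n" for n k
      using sum_lam[of "f n"] sum_nonneg_eq_0_iff[of "{..f n}" "lam (f n)"] lam_f[of _ n] that True by auto
    then have "L (?Y ^ i) = 0" for i
      using moment[of i "f i"] f[of i] by simp
    moreover have "real_distribution (return borel (0::real))"
      by (intro real_distribution.intro prob_space_return real_distribution_axioms.intro) auto
    moreover have "AE x in return borel (0::real). x \<in> {-1..1}"
      by (subst AE_return) auto
    ultimately show ?thesis
      using True by auto
  next
    case False
    then have m: "0 < m"
      using m0 by simp
    define P where "P n = point_measure {..f n} (\<lambda>k. ennreal (lam (f n) k / m))" for n
    define atom where "atom n k = 2 * real k / real (f n) - 1" for n k
    define \<mu> where "\<mu> n = distr (P n) borel (atom n)" for n
    have atom [measurable]: "atom n \<in> P n \<rightarrow>\<^sub>M borel" for n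
      by (simp add: P_def)
    have atom_range: "atom n k \<in> {-1..1}" if "k \<le> f n" for n k
      using that f[of n] by (simp add: atom_def field_simps)
    have prob_P: "prob_space (P n)" for n
    proof (rule prob_spaceI)
      have "emeasure (P n) (space (P n)) = (\<Sum>k\<le>f n. ennreal (lam (f n) k / m))"
        unfolding P_def by (simp add: space_point_measure emeasure_point_measure_finite)
      also have "\<dots> = ennreal (\<Sum>k\<le>f n. lam (f n) k / m)"
        using lam_f m by (intro sum_ennreal) auto
      also have "(\<Sum>k\<le>f n. lam (f n) k / m) = 1"
        using sum_lam[of "f n"] m by (simp flip: sum_divide_distrib)
      finally show "emeasure (P n) (space (P n)) = 1"
        by simp
    qed
    have rd: "real_distribution (\<mu> n)" for n
      unfolding \<mu>_def using prob_P atom by (rule prob_space.real_distribution_distr)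
    have integral_\<mu>: "(LINT x|\<mu> n. h x) = (\<Sum>k\<le>f n. lam (f n) k / m * h (atom n k))"
      if [measurable]: "h \<in> borel_measurable borel" for h n
    proof -
      have "(LINT x|\<mu> n. h x) = (LINT k|P n. h (atom n k))"
        unfolding \<mu>_def by (rule integral_distr[OF atom that])
      also have "\<dots> = (\<Sum>k\<le>f n. (lam (f n) k / m) *\<^sub>R h (atom n k))"
        unfolding P_def using lam_f m by (intro lebesgue_integral_point_measure_finite) auto
      finally show ?thesis
        by simp
    qed
    have "tight \<mu>"
      unfolding tight_def
    proof (intro conjI allI rd impI)
      fix \<epsilon> :: real assume "0 < \<epsilon>"
      \<comment> \<open>Tightness speaks of half-open intervals; the left end -2 keeps the node -1
        inside.\<close>
      have "measure (\<mu> n) {-2<..1} = 1" for n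
      proof -
        have "atom n -` {-2<..1} \<inter> space (P n) = space (P n)"
          using atom_range[of _ n] by (force simp: P_def space_point_measure)
        then show ?thesis
          using prob_space.prob_space[OF prob_P] by (simp add: \<mu>_def measure_distr)
      qed
      then show "\<exists>a b. a < b \<and> (\<forall>n. 1 - \<epsilon> < measure (\<mu> n) {a<..b})"
        using \<open>0 < \<epsilon>\<close> by (intro exI[of _ "-2"] exI[of _ 1]) auto
    qed
    then obtain r M where r: "strict_mono r" and M: "real_distribution M"
      and wc: "weak_conv_m (\<mu> \<circ> id \<circ> r) M"
      using tight_imp_convergent_subsubsequence[of \<mu> id] strict_mono_id by blast
    interpret M: real_distribution M by fact
    have lim: "(\<lambda>n. LINT x|\<mu> (r n). h x) \<longlonglongrightarrow> (LINT x|M. h x)"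
      if "\<And>x. isCont h x" "\<And>x. norm (h x) \<le> B" for h :: "real \<Rightarrow> real" and B
      using weak_conv_imp_integral_bdd_continuous_conv[of "\<mu> \<circ> id \<circ> r" M h B] rd M wc that by simp
    have "AE x in M. x \<in> {-1..1}"
    proof -
      \<comment> \<open>\<open>h\<close> vanishes exactly on [-1, 1], where every
        \<open>\<mu> n\<close> is concentrated, so its integral against the limit is 0.\<close>
      define h where "h x = min 1 (max 0 (\<bar>x\<bar> - 1))" for x :: real
      have h: "isCont h x" "norm (h x) \<le> 1" for x
        unfolding h_def by (auto intro!: continuous_intros)
      have hm [measurable]: "h \<in> borel_measurable borel"
        by (intro borel_measurable_continuous_onI continuous_at_imp_continuous_on ballI h)
      have "(LINT x|\<mu> n. h x) = 0" for n
        unfolding integral_\<mu>[OF hm] using atom_range[of _ n] by (intro sum.neutral) (auto simp: h_def abs_le_iff)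
      then have "(LINT x|M. h x) = 0"
        using lim[OF h] by (simp add: LIMSEQ_const_iff)
      moreover have "integrable M h"
        by (rule M.integrable_const_bound[where B = 1]) (use h in auto)
      ultimately have "AE x in M. h x = 0"
        by (subst (asm) integral_nonneg_eq_0_iff_AE) (auto simp: h_def)
      then show ?thesis
        by eventually_elim (auto simp: h_def min_def max_def split: if_splits)
    qed
    moreover have "m * (LINT x|M. poly (?Y ^ i) (clamp x)) = L (?Y ^ i)" for i
    proof -
      have "(\<lambda>n. (LINT x|\<mu> n. poly (?Y ^ i) (clamp x)) - L (?Y ^ i) / m) \<longlonglongrightarrow> 0"
      proof (rule Lim_null_comparison)
        show "\<forall>\<^sub>F n in sequentially. norm ((LINT x|\<mu> n. poly (?Y ^ i) (clamp x)) - L (?Y ^ i) / m) \<le>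
            (real i)\<^sup>2 / real (f n - i)"
        proof (rule eventually_sequentiallyI)
          fix n assume "i \<le> n"
          then have i: "i < f n"
            using f[of n] by simp
          have "(LINT x|\<mu> n. poly (?Y ^ i) (clamp x)) - L (?Y ^ i) / m =
              (\<Sum>k\<le>f n. lam (f n) k / m * ((real k / real (f n)) ^ i - real (k choose i) / real (f n choose i)))"
          proof -
            have "poly (?Y ^ i) (clamp (atom n k)) = (real k / real (f n)) ^ i" if "k \<le> f n" for k
              using clamp(3)[OF atom_range[OF that]] by (simp add: atom_def field_simps)
            moreover have "L (?Y ^ i) / m = (\<Sum>k\<le>f n. lam (f n) k / m * (real (k choose i) / real (f n choose i)))"
              unfolding moment[OF less_imp_le[OF i], symmetric]
              by (simp only: sum_divide_distrib times_divide_eq_left)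
            ultimately show ?thesis
              by (simp only: integral_\<mu>[OF meas_clamp] right_diff_distrib sum_subtractf) simp
          qed
          also have "norm \<dots> \<le> (\<Sum>k\<le>f n. lam (f n) k / m * ((real i)\<^sup>2 / real (f n - i)))"
          proof (rule sum_norm_le)
            fix k assume "k \<in> {..f n}"
            then show "norm (lam (f n) k / m * ((real k / real (f n)) ^ i - real (k choose i) / real (f n choose i)))
                \<le> lam (f n) k / m * ((real i)\<^sup>2 / real (f n - i))"
              using choose_ratio_power_bound[OF i, of k] lam_f[of k n] m
              unfolding real_norm_def abs_mult abs_minus_commute[of "_ ^ i"]
              by (intro mult_mono) auto
          qed
          also have "\<dots> = (real i)\<^sup>2 / real (f n - i)"
            using sum_lam[of "f n"] m by (simp flip: sum_distrib_right sum_divide_distrib)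
          finally show "norm ((LINT x|\<mu> n. poly (?Y ^ i) (clamp x)) - L (?Y ^ i) / m) \<le>
              (real i)\<^sup>2 / real (f n - i)" .
        qed
        have "filterlim (\<lambda>n. f n - i) at_top sequentially"
          unfolding filterlim_at_top
        proof
          fix Z
          show "\<forall>\<^sub>F n in sequentially. Z \<le> f n - i"
            using f by (intro eventually_sequentiallyI[of "Z + i"]) (metis add.commute le_diff_conv2 less_or_eq_imp_le nat_less_le order_trans trans_le_add2 le_add_diff_inverse)
        qed
        then have "filterlim (\<lambda>n. real (f n - i)) at_top sequentially"
          by (rule filterlim_compose[OF filterlim_real_sequentially])
        then show "(\<lambda>n. (real i)\<^sup>2 / real (f n - i)) \<longlonglongrightarrow> 0"
          by (intro tendsto_divide_0[OF tendsto_const] filterlim_at_top_imp_at_infinity)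
      qed
      then have "(\<lambda>n. LINT x|\<mu> n. poly (?Y ^ i) (clamp x)) \<longlonglongrightarrow> L (?Y ^ i) / m"
        by (simp add: LIM_zero_iff)
      from LIMSEQ_subseq_LIMSEQ[OF this r]
      have "(\<lambda>n. LINT x|\<mu> (r n). poly (?Y ^ i) (clamp x)) \<longlonglongrightarrow> L (?Y ^ i) / m"
        by (simp add: o_def)
      moreover obtain B where "\<And>x. norm (poly (?Y ^ i) (clamp x)) \<le> B"
        using bdd_clamp by blast
      ultimately have "(LINT x|M. poly (?Y ^ i) (clamp x)) = L (?Y ^ i) / m"
        using lim[OF cont_clamp] LIMSEQ_unique by blast
      then show ?thesis
        using m by simp
    qed
    ultimately show ?thesis
      using M by blast
  qed
  then obtain M where "real_distribution M" and M1: "AE x in M. x \<in> {-1..1}"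
    and M2: "\<And>i. m * (LINT x|M. poly (?Y ^ i) (clamp x)) = L (?Y ^ i)"
    by blast
  interpret M: real_distribution M by fact
  have int: "integrable M (\<lambda>x. poly p (clamp x))" for p
  proof -
    obtain B where "\<forall>x. norm (poly p (clamp x)) \<le> B"
      using bdd_clamp by blast
    then show ?thesis
      by (intro M.integrable_const_bound[where B = B]) auto
  qed
  \<comment> \<open>By \<open>M1\<close> the restriction to [-1, 1] loses no mass; the density
    restores the factor \<open>m\<close>.\<close>
  define \<nu> where "\<nu> = density (restrict_space M {-1..1}) (\<lambda>_. ennreal m)"
  have "sets \<nu> = sets (restrict_space borel {-1..1})"
    by (simp add: \<nu>_def) (rule sets_restrict_space_cong, simp)
  moreover have "finite_measure \<nu>"
  proof
    have "emeasure \<nu> (space \<nu>) = ennreal m * emeasure (restrict_space M {-1..1}) (space (restrict_space M {-1..1}))"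
      unfolding \<nu>_def space_density by (rule emeasure_density_const[OF sets.top])
    also have "\<dots> = ennreal m * emeasure M {-1..1}"
      by (subst emeasure_restrict_space) (auto simp: space_restrict_space)
    finally show "emeasure \<nu> (space \<nu>) \<noteq> \<infinity>"
      by (simp add: ennreal_mult_eq_top_iff M.emeasure_finite)
  qed
  moreover have "(LINT s|\<nu>. poly p s) = L p" for p
  proof -
    have "poly p \<in> borel_measurable borel"
      by (intro borel_measurable_continuous_onI continuous_intros)
    then have pm [measurable]: "poly p \<in> borel_measurable M"
      using measurable_cong_sets[OF M.events_eq_borel refl, of borel] by blast
    have "(LINT s|\<nu>. poly p s) = (LINT s|restrict_space M {-1..1}. m * poly p s)"
      unfolding \<nu>_def using m0 pm by (subst integral_real_density) (auto intro: measurable_restrict_space1)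
    also have "\<dots> = (LINT x|M. indicator {-1..1} x *\<^sub>R (m * poly p x))"
      by (rule integral_restrict_space) simp
    also have "\<dots> = (LINT x|M. m * poly p (clamp x))"
    proof (rule integral_cong_AE)
      show "AE x in M. indicator {-1..1} x *\<^sub>R (m * poly p x) = m * poly p (clamp x)"
        using M1 by eventually_elim (simp add: clamp(3))
    qed simp_all
    also have "\<dots> = m * (LINT x|M. poly p (clamp x))"
      by simp
    also have "L p = m * (LINT x|M. poly p (clamp x))"
      by (rule poly_functional_eqI[of L "\<lambda>p. m * (LINT x|M. poly p (clamp x))"])
        (use add smult M2 int in \<open>simp_all add: algebra_simps\<close>)
    finally show ?thesis ..
  qed
  ultimately show ?thesis
    by blast
qed

section \<open>Finite measures on [-1, 1] and their moments\<close>

lemma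
  fixes \<nu> :: "real measure"
  assumes sets: "sets \<nu> = sets (restrict_space borel {-1..1})" and "finite_measure \<nu>"
  shows space_interval_measure: "space \<nu> = {-1..1}"
    and integrable_interval_measure: "continuous_on {-1..1} f \<Longrightarrow> integrable \<nu> (f :: real \<Rightarrow> real)"
proof -
  interpret finite_measure \<nu> by fact
  show space: "space \<nu> = {-1..1}"
    using sets_eq_imp_space_eq[OF sets] by (simp add: space_restrict_space)
  show "integrable \<nu> f" if f: "continuous_on {-1..1} f"
  proof -
    have "bounded (f ` {-1..1})"
      by (intro compact_imp_bounded compact_continuous_image f) auto
    then obtain B where "\<forall>x\<in>{-1..1}. norm (f x) \<le> B"
      unfolding bounded_iff by blast
    moreover have "f \<in> borel_measurable \<nu>"
      using borel_measurable_continuous_on_restrict[OF f] measurable_cong_sets[OF sets refl, of borel] by auto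
    ultimately show ?thesis
      by (intro integrable_const_bound[where B = B]) (auto simp: space)
  qed
qed

text \<open>Equal moments give equal integrals of continuous functions by Weierstrass approximation;
  ramps converging to indicators of open half-lines then compare the measures themselves.\<close>

lemma interval_measure_eqI:
  fixes \<nu> \<nu>' :: "real measure"
  assumes sets: "sets \<nu> = sets (restrict_space borel {-1..1})" "sets \<nu>' = sets (restrict_space borel {-1..1})"
    and fin: "finite_measure \<nu>" "finite_measure \<nu>'"
    and eq: "\<And>i. (LINT s|\<nu>. s ^ i) = (LINT s|\<nu>'. s ^ i)"
  shows "\<nu> = \<nu>'"
proof -
  interpret N: finite_measure \<nu> by fact
  interpret N': finite_measure \<nu>' by fact
  note space = space_interval_measure[OF sets(1) fin(1)] space_interval_measure[OF sets(2) fin(2)]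
  note int = integrable_interval_measure[OF sets(1) fin(1)] integrable_interval_measure[OF sets(2) fin(2)]
  have cont_eq: "(LINT s|\<nu>. f s) = (LINT s|\<nu>'. f s)" if f: "continuous_on {-1..1} f" for f :: "real \<Rightarrow> real"
  proof (rule ccontr)
    assume neq: "(LINT s|\<nu>. f s) \<noteq> (LINT s|\<nu>'. f s)"
    \<comment> \<open>The summand 1 makes \<open>C\<close> positive and the final estimate
      strict.\<close>
    define C where "C = measure \<nu> {-1..1} + measure \<nu>' {-1..1} + 1"
    define e where "e = \<bar>(LINT s|\<nu>. f s) - (LINT s|\<nu>'. f s)\<bar> / C"
    have C: "0 < C"
      by (simp add: C_def add_nonneg_pos)
    then have "0 < e"
      using neq by (simp add: e_def)
    then obtain g where "real_polynomial_function g" and g: "\<And>x. x \<in> {-1..1} \<Longrightarrow> \<bar>f x - g x\<bar> < e"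
      using Stone_Weierstrass_real_polynomial_function[OF _ f] by auto
    then obtain a n where ga: "g = (\<lambda>x. \<Sum>i\<le>n. a i * x ^ i)"
      by (auto simp: real_polynomial_function_iff_sum)
    have gc: "continuous_on {-1..1} g"
      unfolding ga by (intro continuous_intros)
    have "(LINT s|\<nu>. g s) = (LINT s|\<nu>'. g s)"
    proof -
      have "integrable \<nu> (\<lambda>s. s ^ i)" "integrable \<nu>' (\<lambda>s. s ^ i)" for i
        by (intro int continuous_intros)+
      then show ?thesis
        by (simp add: ga eq Bochner_Integration.integral_sum)
    qed
    moreover have bound: "\<bar>(LINT s|K. f s) - (LINT s|K. g s)\<bar> \<le> e * measure K {-1..1}"
      if K: "finite_measure K" "space K = {-1..1}" "integrable K f" "integrable K g" for K
    proof -
      interpret K: finite_measure K by fact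
      have "\<bar>(LINT s|K. f s) - (LINT s|K. g s)\<bar> \<le> (LINT s|K. \<bar>f s - g s\<bar>)"
        using K by (simp flip: Bochner_Integration.integral_diff)
      also have "\<dots> \<le> (LINT s|K. e)"
        using K g by (intro integral_mono) (auto intro: less_imp_le)
      finally show ?thesis
        by (simp add: K mult.commute)
    qed
    ultimately have "\<bar>(LINT s|\<nu>. f s) - (LINT s|\<nu>'. f s)\<bar> \<le> e * measure \<nu> {-1..1} + e * measure \<nu>' {-1..1}"
      using bound[OF fin(1) space(1) int(1)[OF f] int(1)[OF gc]]
        bound[OF fin(2) space(2) int(2)[OF f] int(2)[OF gc]] by linarith
    also have "\<dots> < e * C"
      using \<open>0 < e\<close> by (simp add: C_def algebra_simps)
    also have "e * C = \<bar>(LINT s|\<nu>. f s) - (LINT s|\<nu>'. f s)\<bar>"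
      using C by (simp add: e_def)
    finally show False
      by simp
  qed
  \<comment> \<open>For \<open>n > 0\<close> a ramp rising from 0 at \<open>a\<close> to 1 at
    \<open>a\<close> + 1/n.\<close>
  define f where "f a n s = min 1 (max 0 (real n * (s - a)))" for a s :: real and n
  have f_cont: "continuous_on S (f a n)" for a n S
    unfolding f_def by (intro continuous_intros)
  have f_lim: "(\<lambda>n. f a n s) \<longlonglongrightarrow> indicator {a<..} s" for a s
  proof (cases "a < s")
    case True
    obtain n0 where n0: "1 / (s - a) \<le> real n0"
      using real_arch_simple by blast
    have "\<forall>\<^sub>F n in sequentially. f a n s = 1"
    proof (rule eventually_sequentiallyI)
      fix n assume "n0 \<le> n"
      then have "1 / (s - a) \<le> real n"
        using n0 by linarith
      then have "1 \<le> real n * (s - a)"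
        using True by (simp add: field_simps)
      then show "f a n s = 1"
        by (simp add: f_def)
    qed
    then show ?thesis
      using True by (simp add: tendsto_eventually)
  next
    case False
    then have "real n * (s - a) \<le> 0" for n
      by (simp add: mult_nonneg_nonpos)
    then have "f a n s = 0" for n
      by (simp add: f_def max_absorb1)
    then show ?thesis
      using False by simp
  qed
  have meas_eq: "measure K ({a<..} \<inter> {-1..1}) = lim (\<lambda>n. LINT s|K. f a n s)"
    if K: "finite_measure K" "sets K = sets (restrict_space borel {-1..1})" for a and K :: "real measure"
  proof -
    interpret K: finite_measure K by fact
    have spK: "space K = {-1..1}"
      by (rule space_interval_measure[OF K(2,1)])
    have [measurable]: "f a n \<in> borel_measurable K" for n
      by (rule borel_measurable_integrable) (intro integrable_interval_measure K f_cont)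
    have A: "{a<..} \<inter> {-1..1} \<in> sets K"
      unfolding K(2) by (auto simp: sets_restrict_space)
    have [measurable]: "(indicator {a<..} :: real \<Rightarrow> real) \<in> borel_measurable K"
    proof -
      have "(indicator {a<..} :: real \<Rightarrow> real) \<in> borel_measurable (restrict_space borel {-1..1})"
        by (intro measurable_restrict_space1) simp
      then show ?thesis
        using measurable_cong_sets[OF K(2) refl, of borel] by auto
    qed
    have "(\<lambda>n. LINT s|K. f a n s) \<longlonglongrightarrow> (LINT s|K. indicator {a<..} s)"
    proof (rule integral_dominated_convergence[where w = "\<lambda>_. 1"])
      show "AE s in K. (\<lambda>n. f a n s) \<longlonglongrightarrow> indicator {a<..} s"
        using f_lim by simp
      show "AE s in K. norm (f a n s) \<le> 1" for n
        by (simp add: f_def)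
    qed simp_all
    moreover have "(LINT s|K. indicator {a<..} s) = measure K ({a<..} \<inter> {-1..1})"
    proof -
      have "(LINT s|K. indicator {a<..} s) = (LINT s|K. indicator ({a<..} \<inter> {-1..1}) s :: real)"
        by (rule Bochner_Integration.integral_cong) (auto simp: spK indicator_def)
      then show ?thesis
        using A by simp
    qed
    ultimately show ?thesis
      by (simp add: limI)
  qed
  have distr_emeasure: "emeasure (distr K borel (\<lambda>s. s)) A = emeasure K (A \<inter> {-1..1})"
    if K: "finite_measure K" "sets K = sets (restrict_space borel {-1..1})" and A: "A \<in> sets borel" for A and K :: "real measure"
  proof -
    have "(\<lambda>s. s) \<in> K \<rightarrow>\<^sub>M borel"
      unfolding measurable_cong_sets[OF K(2) refl] by (intro measurable_restrict_space1) simp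
    then show ?thesis
      using A by (subst emeasure_distr) (auto simp: space_interval_measure[OF K(2,1)])
  qed
  \<comment> \<open>Measures are compared on half-lines of the whole real line, so both are pushed
    forward there.\<close>
  have "distr \<nu> borel (\<lambda>s. s) = distr \<nu>' borel (\<lambda>s. s)"
  proof (rule measure_eqI_lessThan)
    show "emeasure (distr \<nu> borel (\<lambda>s. s)) {a<..} < \<infinity>" for a
      by (simp add: distr_emeasure[OF fin(1) sets(1)] N.emeasure_eq_measure)
    show "emeasure (distr \<nu> borel (\<lambda>s. s)) {a<..} = emeasure (distr \<nu>' borel (\<lambda>s. s)) {a<..}" for a
      unfolding distr_emeasure[OF fin(1) sets(1) open_greaterThan[THEN borel_open]]
        distr_emeasure[OF fin(2) sets(2) open_greaterThan[THEN borel_open]]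
        N.emeasure_eq_measure N'.emeasure_eq_measure
      using meas_eq[OF fin(1) sets(1)] meas_eq[OF fin(2) sets(2)] cont_eq[OF f_cont] by simp
  qed simp_all
  then have *: "emeasure \<nu> (A \<inter> {-1..1}) = emeasure \<nu>' (A \<inter> {-1..1})" if "A \<in> sets borel" for A
    using distr_emeasure[OF fin(1) sets(1) that] distr_emeasure[OF fin(2) sets(2) that] by simp
  show ?thesis
  proof (rule measure_eqI)
    show "sets \<nu> = sets \<nu>'"
      using sets by simp
    fix A assume "A \<in> sets \<nu>"
    then obtain B where "B \<in> sets borel" "A = {-1..1} \<inter> B"
      unfolding sets(1) by (auto simp: sets_restrict_space)
    then show "emeasure \<nu> A = emeasure \<nu>' A"
      using *[of B] by (simp add: Int_commute)
  qed
qed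

section \<open>Averages over words\<close>

text \<open>With \<open>t\<close> = 1/q the outward neighbours have total weight q/(q + 1) = 1/(1 +
  \<open>t\<close>) and the inward one \<open>t\<close>/(1 + \<open>t\<close>). At
  \<open>t = 0\<close> this is the shift.\<close>

fun avg_op :: "real \<Rightarrow> (nat \<Rightarrow> real) \<Rightarrow> nat \<Rightarrow> real" where
  "avg_op t u 0 = u 1"
| "avg_op t u (Suc n) = (u (Suc (Suc n)) + t * u n) / (1 + t)"

text \<open>Continuity in \<open>t\<close>, for the passage from finite to infinite rank.\<close>

lemma tendsto_avg_op_pow:
  assumes "(h \<longlongrightarrow> t) F" "t \<noteq> -1"
  shows "((\<lambda>x. (avg_op (h x) ^^ i) u n) \<longlongrightarrow> (avg_op t ^^ i) u n) F"
proof (induction i arbitrary: n)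
  case (Suc i)
  have "1 + t \<noteq> 0"
    using assms(2) by (simp add: add_eq_0_iff2)
  then show ?case
    by (cases n) (auto intro!: tendsto_intros Suc assms)
qed simp

lemma sum_fdist_letters:
  assumes "m \<ge> 1" "x \<in> carrier (free_group (enat m))"
  shows "(\<Sum>a\<in>letters (enat m). g (length (foldr cancel_Cons x [a]))) =
    real (2 * m) * avg_op (1 / real (2 * m - 1)) g (length x)"
proof -
  \<comment> \<open>The detour through the complex numbers makes \<open>sum_neighbours\<close>
    applicable.\<close>
  have "complex_of_real (\<Sum>a\<in>letters (enat m). g (length (foldr cancel_Cons x [a]))) =
      (\<Sum>y\<in>neighbours (enat m) x. complex_of_real (g (length y)))"
    unfolding neighbours_def by (subst sum.reindex[OF inj_mult_letter]) (simp add: free_group_def)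
  also have "\<dots> = complex_of_real (if x = [] then real (2 * m) * g 1
      else g (length x - 1) + real (2 * m - 1) * g (length x + 1))"
    using sum_neighbours[OF assms(2,1), of "\<lambda>n. complex_of_real (g n)"] by (simp del: of_nat_mult)
  finally have *: "(\<Sum>a\<in>letters (enat m). g (length (foldr cancel_Cons x [a]))) =
      (if x = [] then real (2 * m) * g 1
       else g (length x - 1) + real (2 * m - 1) * g (length x + 1))"
    by (simp only: of_real_eq_iff)
  define q where "q = real (2 * m - 1)"
  have q: "0 < q" "real (2 * m) = q + 1"
    using assms(1) by (auto simp: q_def of_nat_diff)
  have avg: "(q + 1) * ((a + 1 / q * b) / (1 + 1 / q)) = b + q * a" for a b
  proof -
    have "a + 1 / q * b = (q * a + b) / q" "1 + 1 / q = (q + 1) / q"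
      using q by (simp_all add: field_simps)
    then show ?thesis
      using q by simp
  qed
  show ?thesis
    unfolding * q(2) q_def[symmetric] using avg by (cases x) simp_all
qed

text \<open>The words are left unreduced: reducing a uniformly chosen walk realises the
  \<open>k\<close>-fold convolution power of the uniform measure on the letters.\<close>

definition walks :: "nat \<Rightarrow> nat \<Rightarrow> fword set" where
  "walks m k = {w. set w \<subseteq> letters (enat m) \<and> length w = k}"

abbreviation reduce :: "fword \<Rightarrow> fword" where
  "reduce w \<equiv> foldr cancel_Cons w []"

lemma finite_walks: "finite (walks m k)"
  unfolding walks_def by (rule finite_lists_length_eq) (rule finite_letters)

lemma card_walks: "card (walks m k) = (2 * m) ^ k"
  unfolding walks_def by (simp only: card_lists_length_eq finite_letters card_letters)

lemma reduce_in_carrier: "w \<in> walks m k \<Longrightarrow> reduce w \<in> carrier (free_group (enat m))"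
  using set_foldr[of w "[]"] by (auto simp: walks_def free_group_def reduced_foldr)

lemma mult_in_carrier:
  assumes "x \<in> carrier (free_group r)" "y \<in> carrier (free_group r)"
  shows "foldr cancel_Cons x y \<in> carrier (free_group r)"
  using monoid.m_closed[OF group.is_monoid[OF group_free_group] assms] by (simp add: free_group_def)

text \<open>The first letter of a walk moves the starting point \<open>x\<close>, and induction
  covers the rest; each letter contributes one averaging and one factor
  \<open>2 * m\<close>.\<close>

lemma sum_walks:
  assumes "m \<ge> 1" "x \<in> carrier (free_group (enat m))"
  shows "(\<Sum>w\<in>walks m k. u (length (foldr cancel_Cons x (reduce w)))) =
    real (2 * m) ^ k * (avg_op (1 / real (2 * m - 1)) ^^ k) u (length x)"
  using assms(2)
proof (induction k arbitrary: x)
  case 0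
  then have "walks m 0 = {[]}" "reduced_word x"
    by (auto simp: walks_def free_group_def)
  then show ?case
    using foldr_reduced[of x "[]"] by simp
next
  case (Suc k)
  let ?A = "avg_op (1 / real (2 * m - 1))"
  have W: "walks m (Suc k) = (\<lambda>(w, a). a # w) ` (walks m k \<times> letters (enat m))"
    unfolding walks_def by (rule lists_length_Suc_eq)
  have "(\<Sum>w\<in>walks m (Suc k). u (length (foldr cancel_Cons x (reduce w)))) =
      (\<Sum>(w, a)\<in>walks m k \<times> letters (enat m). u (length (foldr cancel_Cons x (reduce (a # w)))))"
    unfolding W by (subst sum.reindex) (auto simp: inj_on_def case_prod_unfold)
  also have "\<dots> = (\<Sum>a\<in>letters (enat m). \<Sum>w\<in>walks m k. u (length (foldr cancel_Cons x (reduce (a # w)))))"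
    by (subst sum.swap) (simp add: sum.cartesian_product)
  also have "\<dots> = (\<Sum>a\<in>letters (enat m). real (2 * m) ^ k * (?A ^^ k) u (length (foldr cancel_Cons x [a])))"
  proof (rule sum.cong)
    fix a assume a: "a \<in> letters (enat m)"
    have "foldr cancel_Cons x (reduce (a # w)) = foldr cancel_Cons (foldr cancel_Cons x [a]) (reduce w)" for w
      by (simp add: foldr_assoc reduced_foldr)
    moreover have "[a] \<in> carrier (free_group (enat m))"
      using a by (simp add: free_group_def reduced_Cons)
    ultimately show "(\<Sum>w\<in>walks m k. u (length (foldr cancel_Cons x (reduce (a # w))))) =
        real (2 * m) ^ k * (?A ^^ k) u (length (foldr cancel_Cons x [a]))"
      using Suc.IH[OF mult_in_carrier[OF Suc.prems]] by simp
  qed simp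
  also have "\<dots> = real (2 * m) ^ k * (real (2 * m) * ?A ((?A ^^ k) u) (length x))"
    unfolding sum_fdist_letters[OF assms(1) Suc.prems, symmetric] by (simp add: sum_distrib_left)
  finally show ?case
    by simp
qed

lemma inv_in_carrier:
  "x \<in> carrier (free_group r) \<Longrightarrow> rev (map inv_letter x) \<in> carrier (free_group r)"
  by (auto simp: free_group_def reduced_rev_inv)

text \<open>Summing over \<open>w\<close> first, with the inverse of \<open>w'\<close> as starting
  point, leaves a function of the length of \<open>w'\<close>, which is then summed over walks from
  the identity.\<close>

lemma sum_walks_fdist:
  assumes "m \<ge> 1"
  shows "(\<Sum>w\<in>walks m k. \<Sum>w'\<in>walks m l. u (fdist (reduce w) (reduce w'))) =
    real (2 * m) ^ (k + l) * (avg_op (1 / real (2 * m - 1)) ^^ (k + l)) u 0"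
proof -
  let ?A = "avg_op (1 / real (2 * m - 1))"
  have "(\<Sum>w\<in>walks m k. \<Sum>w'\<in>walks m l. u (fdist (reduce w) (reduce w'))) =
      (\<Sum>w'\<in>walks m l. \<Sum>w\<in>walks m k. u (length (foldr cancel_Cons (rev (map inv_letter (reduce w'))) (reduce w))))"
    by (subst sum.swap) (simp add: fdist_def)
  also have "\<dots> = (\<Sum>w'\<in>walks m l. real (2 * m) ^ k * (?A ^^ k) u (length (foldr cancel_Cons [] (reduce w'))))"
    using sum_walks[OF assms inv_in_carrier[OF reduce_in_carrier]] by (intro sum.cong) auto
  also have "\<dots> = real (2 * m) ^ k * (real (2 * m) ^ l * (?A ^^ l) ((?A ^^ k) u) 0)"
    using sum_walks[OF assms, of "[]" "(?A ^^ k) u" l]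
    by (simp add: free_group_def del: of_nat_mult flip: sum_distrib_left)
  also have "(?A ^^ l) ((?A ^^ k) u) = (?A ^^ (k + l)) u"
    by (simp add: add.commute[of k] funpow_add)
  finally show ?thesis
    by (simp add: power_add)
qed

text \<open>Translation by \<open>h\<close> changes only the starting point of the walk
  \<open>w\<close>, so the sum over \<open>w\<close> reduces the claim to
  \<open>sum_walks_fdist\<close>.\<close>

lemma sum_walks_fdist_translate:
  assumes "m \<ge> 1"
  shows "(\<Sum>h\<in>walks m j. \<Sum>w\<in>walks m k. \<Sum>w'\<in>walks m l. u (fdist (foldr cancel_Cons (reduce h) (reduce w)) (reduce w'))) =
    real (2 * m) ^ (j + k + l) * (avg_op (1 / real (2 * m - 1)) ^^ (j + k + l)) u 0"
proof -
  let ?A = "avg_op (1 / real (2 * m - 1))"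
  have inner: "(\<Sum>w\<in>walks m k. u (fdist (foldr cancel_Cons (reduce h) (reduce w)) (reduce w'))) =
      real (2 * m) ^ k * (?A ^^ k) u (fdist (reduce h) (reduce w'))"
    if "h \<in> walks m j" "w' \<in> walks m l" for h w'
  proof -
    let ?z = "rev (map inv_letter (reduce w'))"
    have z: "?z \<in> carrier (free_group (enat m))" and h: "reduce h \<in> carrier (free_group (enat m))"
      using inv_in_carrier[OF reduce_in_carrier[OF that(2)]] reduce_in_carrier[OF that(1)] by auto
    have "fdist (foldr cancel_Cons (reduce h) (reduce w)) (reduce w') =
        length (foldr cancel_Cons (foldr cancel_Cons ?z (reduce h)) (reduce w))" for w
      unfolding fdist_def by (subst foldr_assoc[of "reduce w" ?z]) (simp_all add: reduced_foldr)
    then show ?thesis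
      using sum_walks[OF assms mult_in_carrier[OF z h], of u k] by (simp add: fdist_def)
  qed
  have "(\<Sum>h\<in>walks m j. \<Sum>w\<in>walks m k. \<Sum>w'\<in>walks m l. u (fdist (foldr cancel_Cons (reduce h) (reduce w)) (reduce w'))) =
      (\<Sum>h\<in>walks m j. \<Sum>w'\<in>walks m l. \<Sum>w\<in>walks m k. u (fdist (foldr cancel_Cons (reduce h) (reduce w)) (reduce w')))"
    by (intro sum.cong sum.swap) simp
  also have "\<dots> = (\<Sum>h\<in>walks m j. \<Sum>w'\<in>walks m l. real (2 * m) ^ k * (?A ^^ k) u (fdist (reduce h) (reduce w')))"
    using inner by (intro sum.cong) auto
  also have "\<dots> = real (2 * m) ^ k * (real (2 * m) ^ (j + l) * (?A ^^ (j + l)) ((?A ^^ k) u) 0)"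
    unfolding sum_walks_fdist[OF assms, symmetric] by (simp add: sum_distrib_left)
  also have "(?A ^^ (j + l)) ((?A ^^ k) u) = (?A ^^ (j + l + k)) u"
    by (simp add: funpow_add)
  finally show ?thesis
    by (simp add: power_add mult_ac add_ac)
qed

section \<open>Conditional negativity of profiles, with real coefficients and finite rank\<close>

definition cnd_profile :: "nat \<Rightarrow> (nat \<Rightarrow> real) \<Rightarrow> bool" where
  "cnd_profile m u \<longleftrightarrow> (\<forall>n (x :: nat \<Rightarrow> fword) (c :: nat \<Rightarrow> real).
     (\<forall>j<n. x j \<in> carrier (free_group (enat m))) \<and> (\<Sum>j<n. c j) = 0 \<longrightarrow>
     (\<Sum>j<n. \<Sum>k<n. c j * c k * u (fdist (x j) (x k))) \<le> 0)"

lemma cnd_profile_sum: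
  assumes "cnd_profile m u" "finite I" "\<And>i. i \<in> I \<Longrightarrow> X i \<in> carrier (free_group (enat m))"
    and "(\<Sum>i\<in>I. c i) = 0"
  shows "(\<Sum>i\<in>I. \<Sum>j\<in>I. c i * c j * u (fdist (X i) (X j))) \<le> 0"
proof -
  obtain h where h: "bij_betw h {..<card I} I"
    using ex_bij_betw_nat_finite[OF assms(2)] by (auto simp: atLeast0LessThan)
  have "(\<Sum>j<card I. \<Sum>k<card I. c (h j) * c (h k) * u (fdist (X (h j)) (X (h k)))) \<le> 0"
    using assms(1)[unfolded cnd_profile_def, rule_format, of "card I" "X \<circ> h" "c \<circ> h"] assms(3,4)
      bij_betwE[OF h] sum.reindex_bij_betw[OF h, of c] by simp
  also have "(\<Sum>j<card I. \<Sum>k<card I. c (h j) * c (h k) * u (fdist (X (h j)) (X (h k)))) =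
      (\<Sum>j<card I. \<Sum>k\<in>I. c (h j) * c k * u (fdist (X (h j)) (X k)))"
    by (intro sum.cong refl sum.reindex_bij_betw[OF h])
  also have "\<dots> = (\<Sum>i\<in>I. \<Sum>j\<in>I. c i * c j * u (fdist (X i) (X j)))"
    by (rule sum.reindex_bij_betw[OF h])
  finally show ?thesis .
qed

lemma fdist_translate:
  assumes "x \<in> carrier (free_group r)" "y \<in> carrier (free_group r)" "h \<in> carrier (free_group r)"
  shows "fdist (foldr cancel_Cons h x) (foldr cancel_Cons h y) = fdist x y"
proof -
  interpret group "free_group r"
    by (rule group_free_group)
  have "inv\<^bsub>free_group r\<^esub> (h \<otimes>\<^bsub>free_group r\<^esub> y) \<otimes>\<^bsub>free_group r\<^esub> (h \<otimes>\<^bsub>free_group r\<^esub> x) =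
      inv\<^bsub>free_group r\<^esub> y \<otimes>\<^bsub>free_group r\<^esub> x"
    using assms by (simp add: inv_mult_group m_assoc inv_solve_left flip: m_assoc[of "inv\<^bsub>free_group r\<^esub> h"])
  moreover have "foldr cancel_Cons a b = a \<otimes>\<^bsub>free_group r\<^esub> b" for a b
    by (simp add: free_group_def)
  ultimately show ?thesis
    using assms fdist_eq m_closed by metis
qed

text \<open>Conditional negativity is tested on the weights \<open>c\<close> minus their translate
  by \<open>h\<close>, whose total is 0 for every \<open>c\<close>. The diagonal blocks agree by
  invariance of the metric, the mixed ones by its symmetry.\<close>

lemma cnd_profile_translate:
  assumes cnd: "cnd_profile m u" and I: "finite I" "\<And>i. i \<in> I \<Longrightarrow> X i \<in> carrier (free_group (enat m))"
    and h: "h \<in> carrier (free_group (enat m))"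
  shows "(\<Sum>i\<in>I. \<Sum>j\<in>I. c i * c j * (u (fdist (X i) (X j)) - u (fdist (foldr cancel_Cons h (X i)) (X j)))) \<le> 0"
proof -
  let ?C = "carrier (free_group (enat m))"
  \<comment> \<open>The index set is doubled: the copy \<open>True\<close> holds the translated
    points, with negated weights in \<open>d\<close>.\<close>
  define Y where "Y = (\<lambda>(b, i). if b then foldr cancel_Cons h (X i) else X i)"
  define d where "d = (\<lambda>(b, i). if b then - c i else c i)"
  have red: "reduced_word x" if "x \<in> ?C" for x
    using that by (simp add: free_group_def)
  have Y: "Y p \<in> ?C" if "p \<in> UNIV \<times> I" for p
    using that I(2) h by (auto simp: Y_def mult_in_carrier split: prod.splits)
  have split: "(\<Sum>p\<in>UNIV \<times> I. F p) = (\<Sum>i\<in>I. F (False, i)) + (\<Sum>i\<in>I. F (True, i))" for F :: "bool \<times> 'a \<Rightarrow> real"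
    by (simp add: UNIV_bool sum.cartesian_product')
  have "(\<Sum>p\<in>UNIV \<times> I. d p) = 0"
    by (simp add: split d_def sum_negf)
  then have "(\<Sum>p\<in>UNIV \<times> I. \<Sum>q\<in>UNIV \<times> I. d p * d q * u (fdist (Y p) (Y q))) \<le> 0"
    using cnd_profile_sum[OF cnd, of "UNIV \<times> I" Y d] I(1) Y by simp
  moreover have "(\<Sum>p\<in>UNIV \<times> I. \<Sum>q\<in>UNIV \<times> I. d p * d q * u (fdist (Y p) (Y q))) =
      (\<Sum>i\<in>I. \<Sum>j\<in>I. d (False, i) * d (False, j) * u (fdist (Y (False, i)) (Y (False, j)))) +
      (\<Sum>i\<in>I. \<Sum>j\<in>I. d (False, i) * d (True, j) * u (fdist (Y (False, i)) (Y (True, j)))) +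
      ((\<Sum>i\<in>I. \<Sum>j\<in>I. d (True, i) * d (False, j) * u (fdist (Y (True, i)) (Y (False, j)))) +
       (\<Sum>i\<in>I. \<Sum>j\<in>I. d (True, i) * d (True, j) * u (fdist (Y (True, i)) (Y (True, j)))))"
    by (simp add: split sum.distrib)
  moreover have "(\<Sum>i\<in>I. \<Sum>j\<in>I. d (False, i) * d (True, j) * u (fdist (Y (False, i)) (Y (True, j)))) =
      - (\<Sum>i\<in>I. \<Sum>j\<in>I. c i * c j * u (fdist (foldr cancel_Cons h (X i)) (X j)))"
    unfolding sum_negf[symmetric]
    by (subst sum.swap, intro sum.cong refl)
      (use I h red fdist_commute in \<open>auto simp: d_def Y_def mult_in_carrier mult_ac\<close>)
  moreover have "(\<Sum>i\<in>I. \<Sum>j\<in>I. d (True, i) * d (True, j) * u (fdist (Y (True, i)) (Y (True, j)))) =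
      (\<Sum>i\<in>I. \<Sum>j\<in>I. c i * c j * u (fdist (X i) (X j)))"
    using I h by (intro sum.cong refl) (simp add: d_def Y_def fdist_translate[where r = "enat m"])
  ultimately show ?thesis
    by (simp add: d_def Y_def sum_negf right_diff_distrib sum_subtractf)
qed

section \<open>Positivity of the moment functional in finite rank\<close>

context
  fixes m :: nat and u :: "nat \<Rightarrow> real" and M :: "nat \<Rightarrow> real"
  assumes m: "m \<ge> 1" and cnd: "cnd_profile m u"
    and M: "M = (\<lambda>i. (avg_op (1 / real (2 * m - 1)) ^^ i) u 0)"
begin

private definition degr :: real where "degr = real (2 * m)"

private lemma degr_nonzero: "degr \<noteq> 0"
  using m by (simp add: degr_def)

private lemma real_card_walks: "real (card (walks m k)) = degr ^ k"
  unfolding card_walks degr_def by (rule of_nat_power)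

private lemma M_eq: "M i = (avg_op (1 / real (2 * m - 1)) ^^ i) u 0"
  by (simp add: M)

private definition walk_index :: "real poly \<Rightarrow> (nat \<times> fword) set" where
  "walk_index p = (SIGMA k:{..degree p}. walks m k)"

text \<open>The weights of the group algebra element p(\<mu>), \<mu> being uniform on the letters:
  each of the \<open>degr ^ k\<close> walks of length \<open>k\<close> gets an equal share of the
  coefficient of X^k.\<close>

private definition walk_weight :: "real poly \<Rightarrow> nat \<times> fword \<Rightarrow> real" where
  "walk_weight p i = coeff p (fst i) / degr ^ fst i"

private lemma finite_walk_index: "finite (walk_index p)"
  by (simp add: walk_index_def finite_walks)

private lemma reduce_walk_index: "i \<in> walk_index p \<Longrightarrow> reduce (snd i) \<in> carrier (free_group (enat m))"
  by (auto simp: walk_index_def intro: reduce_in_carrier)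

private lemma sum_walk_index:
  "(\<Sum>i\<in>walk_index p. F i) = (\<Sum>k\<le>degree p. \<Sum>w\<in>walks m k. F (k, w))"
  unfolding walk_index_def by (subst sum.Sigma) (simp_all add: finite_walks)

private lemma sum_walk_weight: "(\<Sum>i\<in>walk_index p. walk_weight p i) = poly p 1"
proof -
  have "coeff p k = (\<Sum>w\<in>walks m k. walk_weight p (k, w))" for k
    using degr_nonzero by (simp add: walk_weight_def real_card_walks)
  then show ?thesis
    by (simp add: sum_walk_index poly_altdef)
qed

text \<open>A kernel whose normalised walk sums depend on \<open>k + l\<close> alone sees only the
  product \<open>p * p\<close>. The sequence \<open>C\<close> is left open to serve two
  kernels.\<close>

private lemma sum_walk_weight_pairs:
  assumes "\<And>k l. (\<Sum>w\<in>walks m k. \<Sum>w'\<in>walks m l. g w w') = degr ^ (k + l) * C (k + l)"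
  shows "(\<Sum>i\<in>walk_index p. \<Sum>j\<in>walk_index p. walk_weight p i * walk_weight p j * g (snd i) (snd j)) =
    moment_functional C (p * p)"
proof -
  have "(\<Sum>i\<in>walk_index p. \<Sum>j\<in>walk_index p. walk_weight p i * walk_weight p j * g (snd i) (snd j)) =
      (\<Sum>k\<le>degree p. \<Sum>l\<le>degree p. \<Sum>w\<in>walks m k. \<Sum>w'\<in>walks m l.
        walk_weight p (k, w) * walk_weight p (l, w') * g w w')"
    unfolding sum_walk_index snd_conv by (intro sum.cong refl) (rule sum.swap)
  also have "\<dots> = (\<Sum>k\<le>degree p. \<Sum>l\<le>degree p. coeff p k * coeff p l * C (k + l))"
  proof (intro sum.cong refl)
    fix k l
    have "(\<Sum>w\<in>walks m k. \<Sum>w'\<in>walks m l. walk_weight p (k, w) * walk_weight p (l, w') * g w w') =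
        coeff p k / degr ^ k * (coeff p l / degr ^ l) * (\<Sum>w\<in>walks m k. \<Sum>w'\<in>walks m l. g w w')"
      by (simp add: walk_weight_def sum_distrib_left)
    also have "\<dots> = coeff p k * coeff p l * C (k + l)"
      unfolding assms using degr_nonzero by (simp add: power_add)
    finally show "(\<Sum>w\<in>walks m k. \<Sum>w'\<in>walks m l. walk_weight p (k, w) * walk_weight p (l, w') * g w w') =
        coeff p k * coeff p l * C (k + l)" .
  qed
  finally show ?thesis
    by (simp add: moment_functional_square)
qed

text \<open>The weights of p(\<mu>) add up to \<open>poly p 1\<close>, so the hypothesis makes them
  admissible in conditional negativity.\<close>

lemma moment_functional_square_nonpos:
  assumes "poly p 1 = 0"
  shows "moment_functional M (p * p) \<le> 0"
proof -
  have "(\<Sum>i\<in>walk_index p. \<Sum>j\<in>walk_index p. walk_weight p i * walk_weight p j *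
      u (fdist (reduce (snd i)) (reduce (snd j)))) \<le> 0"
    using assms by (intro cnd_profile_sum[OF cnd]) (simp_all add: finite_walk_index reduce_walk_index sum_walk_weight)
  then show ?thesis
    by (subst (asm) sum_walk_weight_pairs[where C = M]) (simp_all only: sum_walks_fdist[where u = u, OF m, folded degr_def M_eq])
qed

text \<open>Summing \<open>cnd_profile_translate\<close> over products \<open>h\<close> of two
  letters adds two averagings to the translated term; this evaluates the functional of
  \<open>M\<close> at 1 - X^2 times \<open>p * p\<close>.\<close>

lemma moment_functional_square_difference:
  "moment_functional (\<lambda>i. M i - M (Suc (Suc i))) (p * p) \<le> 0"
proof -
  let ?H = "walks m 2"
  define g where "g w w' = (\<Sum>h\<in>?H. u (fdist (reduce w) (reduce w')) -
    u (fdist (foldr cancel_Cons (reduce h) (reduce w)) (reduce w')))" for w w'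
  have "(\<Sum>i\<in>walk_index p. \<Sum>j\<in>walk_index p. walk_weight p i * walk_weight p j * g (snd i) (snd j)) =
      (\<Sum>h\<in>?H. \<Sum>i\<in>walk_index p. \<Sum>j\<in>walk_index p. walk_weight p i * walk_weight p j *
        (u (fdist (reduce (snd i)) (reduce (snd j))) -
         u (fdist (foldr cancel_Cons (reduce h) (reduce (snd i))) (reduce (snd j)))))"
    unfolding g_def sum_distrib_left
    by (simp only: sum.swap[of _ ?H])
  also have "\<dots> \<le> 0"
    by (intro sum_nonpos cnd_profile_translate[OF cnd])
      (simp_all add: finite_walk_index reduce_walk_index reduce_in_carrier)
  finally have "(\<Sum>i\<in>walk_index p. \<Sum>j\<in>walk_index p. walk_weight p i * walk_weight p j * g (snd i) (snd j)) \<le> 0" .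
  moreover have "(\<Sum>w\<in>walks m k. \<Sum>w'\<in>walks m l. g w w') =
      degr ^ (k + l) * (degr\<^sup>2 * (M (k + l) - M (Suc (Suc (k + l)))))" for k l
  proof -
    have "(\<Sum>w\<in>walks m k. \<Sum>w'\<in>walks m l. g w w') =
        degr\<^sup>2 * (\<Sum>w\<in>walks m k. \<Sum>w'\<in>walks m l. u (fdist (reduce w) (reduce w'))) -
        (\<Sum>w\<in>walks m k. \<Sum>w'\<in>walks m l. \<Sum>h\<in>?H.
          u (fdist (foldr cancel_Cons (reduce h) (reduce w)) (reduce w')))"
      by (simp add: g_def sum_subtractf sum_distrib_left real_card_walks)
    also have "(\<Sum>w\<in>walks m k. \<Sum>w'\<in>walks m l. \<Sum>h\<in>?H.
          u (fdist (foldr cancel_Cons (reduce h) (reduce w)) (reduce w'))) =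
        (\<Sum>h\<in>?H. \<Sum>w\<in>walks m k. \<Sum>w'\<in>walks m l.
          u (fdist (foldr cancel_Cons (reduce h) (reduce w)) (reduce w')))"
      by (simp only: sum.swap[of _ ?H])
    finally show ?thesis
      unfolding sum_walks_fdist[where u = u, OF m, folded degr_def M_eq] sum_walks_fdist_translate[where u = u, OF m, folded degr_def M_eq]
      by (simp add: power_add power2_eq_square algebra_simps)
  qed
  ultimately have "moment_functional (\<lambda>i. degr\<^sup>2 * (M i - M (Suc (Suc i)))) (p * p) \<le> 0"
    by (subst (asm) sum_walk_weight_pairs[where C = "\<lambda>i. degr\<^sup>2 * (M i - M (Suc (Suc i)))"])
  then have "degr\<^sup>2 * moment_functional (\<lambda>i. M i - M (Suc (Suc i))) (p * p) \<le> 0"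
    by (simp add: moment_functional_def sum_distrib_left mult.left_commute)
  then show ?thesis
    using degr_nonzero by (simp add: mult_le_0_iff)
qed

text \<open>For odd \<open>N\<close>, multiplying the Bernstein polynomial by \<open>(1 - X) / 2\<close> gives either the square of
  a polynomial that vanishes at \<open>1\<close>, or \<open>(1 - X\<^sup>2) / 4\<close> times a square.\<close>

lemma bernstein_functional_nonneg:
  assumes "odd N" "k \<le> N"
  shows "0 \<le> moment_functional (\<lambda>i. M (Suc i) - M i) ([:1/2, 1/2:] ^ k * [:1/2, -1/2:] ^ (N - k))"
proof -
  let ?Y = "[:1/2, 1/2:] :: real poly" and ?Z = "[:1/2, -1/2:] :: real poly"
  \<comment> \<open>Moments \<open>M (Suc i) - M i\<close> belong to the functional of
    \<open>M\<close> after multiplication by X - 1 = -2 \<open>?Z\<close>.\<close>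
  have diff: "moment_functional (\<lambda>i. M (Suc i) - M i) p = -2 * moment_functional M (?Z * p)" for p
  proof -
    have "?Z * p = smult (1/2) (p + smult (-1) (pCons 0 p))"
      by (simp add: smult_add_right)
    then have "moment_functional M (?Z * p) =
        (moment_functional M p - moment_functional (\<lambda>i. M (Suc i)) p) / 2"
      by (simp only: moment_functional_smult moment_functional_add moment_functional_pCons) simp
    then show ?thesis
      by (simp add: moment_functional_def sum_subtractf algebra_simps)
  qed
  \<comment> \<open>Likewise 1 - X^2 = 4 \<open>?Y * ?Z\<close>.\<close>
  have square: "moment_functional (\<lambda>i. M i - M (Suc (Suc i))) p = 4 * moment_functional M (?Y * ?Z * p)" for p
  proof -
    have "?Y * ?Z * p = smult (1/4) (p + smult (-1) (pCons 0 (pCons 0 p)))"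
      by (simp add: smult_add_right)
    then have "moment_functional M (?Y * ?Z * p) =
        (moment_functional M p - moment_functional (\<lambda>i. M (Suc (Suc i))) p) / 4"
      by (simp only: moment_functional_smult moment_functional_add moment_functional_pCons) simp
    then show ?thesis
      by (simp add: moment_functional_def sum_subtractf algebra_simps)
  qed
  have "moment_functional M (?Z * (?Y ^ k * ?Z ^ (N - k))) \<le> 0"
  proof (cases "even k")
    case True
    then obtain a where a: "k = 2 * a" ..
    have "odd (N - k)"
      using assms True by simp
    then obtain b where b: "N - k = 2 * b + 1" ..
    have "?Z * (?Y ^ k * ?Z ^ (N - k)) = (?Y ^ a * ?Z ^ Suc b) * (?Y ^ a * ?Z ^ Suc b)"
      unfolding b unfolding a mult_2 power_add by (simp only: power_Suc power_one_right mult_ac)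
    then show ?thesis
      using moment_functional_square_nonpos[of "?Y ^ a * ?Z ^ Suc b"] by simp
  next
    case False
    then obtain a where a: "k = 2 * a + 1" ..
    have "even (N - k)"
      using assms False by simp
    then obtain b where b: "N - k = 2 * b" ..
    have "?Z * (?Y ^ k * ?Z ^ (N - k)) = ?Y * ?Z * ((?Y ^ a * ?Z ^ b) * (?Y ^ a * ?Z ^ b))"
      unfolding b unfolding a mult_2 power_add by (simp only: power_one_right mult_ac)
    then show ?thesis
      using moment_functional_square_difference[of "?Y ^ a * ?Z ^ b"] unfolding square by simp
  qed
  then show ?thesis
    unfolding diff by simp
qed

end

section \<open>The integral representation\<close>

lemma represents_iff:
  assumes "1 \<le> r"
  shows "represents r \<nu> \<psi> \<longleftrightarrow>
    sets \<nu> = sets (restrict_space borel {-1..1}) \<and> finite_measure \<nu> \<and>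
    (\<forall>x\<in>carrier (free_group r). \<psi> x = complex_of_real (LINT s|\<nu>. sph_quot (inv_branching r) s (length x)))"
  unfolding represents_def psi_sph_eq[OF assms] of_real_sph_quot[symmetric] integral_complex_of_real ..

text \<open>Powers of one generator supply an element of every length.\<close>

lemma replicate_in_carrier:
  assumes "1 \<le> r"
  shows "replicate n (0, True) \<in> carrier (free_group r)"
proof -
  have "successively (\<lambda>a b. b \<noteq> inv_letter a) (replicate n (0, True))"
    by (induction n) (auto simp: successively_Cons inv_letter_def)
  moreover have "enat 0 < r"
    using assms by (cases r) (auto simp: one_enat_def)
  ultimately show ?thesis
    by (auto simp: free_group_def reduced_word_def letters_def)
qed

text \<open>The recurrence expresses \<open>s * sph_quot ?t s (Suc k)\<close> without the factor
  \<open>s\<close>, so induction on \<open>i\<close> determines all integrals of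
  \<open>s ^ i * sph_quot ?t s n\<close>; \<open>n = 1\<close> gives the moments.\<close>

lemma represents_unique:
  assumes r: "1 \<le> r" and "represents r \<nu> \<psi>" "represents r \<nu>' \<psi>"
  shows "\<nu> = \<nu>'"
proof -
  let ?t = "inv_branching r"
  have sets: "sets \<nu> = sets (restrict_space borel {-1..1})" "sets \<nu>' = sets (restrict_space borel {-1..1})"
    and fin: "finite_measure \<nu>" "finite_measure \<nu>'"
    using assms by (auto simp: represents_def)
  note int = integrable_interval_measure[OF sets(1) fin(1)] integrable_interval_measure[OF sets(2) fin(2)]
  have t: "1 + ?t \<noteq> 0"
    using inv_branching_nonneg[of r] by linarith
  have base: "(LINT s|\<nu>. sph_quot ?t s n) = (LINT s|\<nu>'. sph_quot ?t s n)" for n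
  proof -
    have "\<forall>x\<in>carrier (free_group r). \<psi> x = complex_of_real (LINT s|\<nu>. sph_quot ?t s (length x))"
      "\<forall>x\<in>carrier (free_group r). \<psi> x = complex_of_real (LINT s|\<nu>'. sph_quot ?t s (length x))"
      using assms(2,3) unfolding represents_iff[OF r] by blast+
    from this[THEN bspec, OF replicate_in_carrier[OF r, of n]]
    have "complex_of_real (LINT s|\<nu>. sph_quot ?t s n) = complex_of_real (LINT s|\<nu>'. sph_quot ?t s n)"
      by (metis length_replicate)
    then show ?thesis
      by (rule of_real_eq_iff[THEN iffD1])
  qed
  have linear: "(LINT s|\<nu>. a * f s + b * g s + c * h s) = (LINT s|\<nu>'. a * f s + b * g s + c * h s)"
    if "continuous_on {-1..1} f" "continuous_on {-1..1} g" "continuous_on {-1..1} h"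
      "(LINT s|\<nu>. f s) = (LINT s|\<nu>'. f s)" "(LINT s|\<nu>. g s) = (LINT s|\<nu>'. g s)"
      "(LINT s|\<nu>. h s) = (LINT s|\<nu>'. h s)"
    for a b c :: real and f g h
    using that int by simp
  have "(LINT s|\<nu>. s ^ i * sph_quot ?t s n) = (LINT s|\<nu>'. s ^ i * sph_quot ?t s n)" for i n
  proof (induction i arbitrary: n)
    case 0
    show ?case
      using base[of n] by simp
  next
    case (Suc i)
    show ?case
    proof (cases n)
      case (Suc k)
      \<comment> \<open>The term \<open>s ^ i\<close> is written with
        \<open>sph_quot ?t s (Suc 0)\<close>, which is 1, to fit the induction hypothesis.\<close>
      have *: "s ^ Suc i * sph_quot ?t s (Suc k) =
          1 / (1 + ?t) * (s ^ i * sph_quot ?t s (Suc (Suc k))) + ?t / (1 + ?t) * (s ^ i * sph_quot ?t s k) +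
          (-1) * (s ^ i * sph_quot ?t s (Suc 0))" for s
      proof -
        have "s ^ i * sph_quot ?t s (Suc (Suc k)) + ?t * (s ^ i * sph_quot ?t s k) =
            (1 + ?t) * (s ^ Suc i * sph_quot ?t s (Suc k) + s ^ i)"
          by (simp add: algebra_simps)
        then have "s ^ Suc i * sph_quot ?t s (Suc k) =
            (s ^ i * sph_quot ?t s (Suc (Suc k)) + ?t * (s ^ i * sph_quot ?t s k)) / (1 + ?t) - s ^ i"
          using t by (simp del: sph_quot.simps(3))
        then show ?thesis
          by (simp add: add_divide_distrib del: sph_quot.simps(3))
      qed
      show ?thesis
        unfolding Suc * by (intro linear Suc.IH continuous_intros continuous_on_sph_quot)
    qed simp
  qed
  from this[of _ "Suc 0"] show ?thesis
    by (intro interval_measure_eqI sets fin) simp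
qed

lemma represents_total_mass:
  assumes r: "1 \<le> r" and "represents r \<nu> \<psi>" "x \<in> carrier (free_group r)" "length x = 1"
  shows "complex_of_real (measure \<nu> {-1..1}) = \<psi> x"
  using assms space_interval_measure[of \<nu>] unfolding represents_iff[OF r] by auto

text \<open>For infinite rank, positivity in each finite rank \<open>m\<close>, with
  \<open>t\<close> = 1/(2m - 1), passes to the limit \<open>t\<close> = 0 at a fixed
  polynomial.\<close>

lemma bernstein_functional_nonneg_rank:
  assumes r: "1 \<le> r" and cnd: "\<And>m. 1 \<le> m \<Longrightarrow> enat m \<le> r \<Longrightarrow> cnd_profile m u"
    and N: "odd N" "k \<le> N"
  defines "A \<equiv> avg_op (inv_branching r)"
  shows "0 \<le> moment_functional (\<lambda>i. (A ^^ Suc i) u 0 - (A ^^ i) u 0) ([:1/2, 1/2:] ^ k * [:1/2, -1/2:] ^ (N - k))"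
    (is "0 \<le> moment_functional _ ?p")
proof (cases r)
  case (enat m)
  then have "1 \<le> m"
    using r by (simp add: one_enat_def)
  then show ?thesis
    using bernstein_functional_nonneg[OF _ cnd refl N] unfolding A_def
    by (simp add: enat inv_branching_def del: funpow.simps)
next
  case infinity
  let ?F = "\<lambda>t. moment_functional (\<lambda>i. (avg_op t ^^ Suc i) u 0 - (avg_op t ^^ i) u 0) ?p"
  have "filterlim (\<lambda>m. 2 * m - 1 :: nat) at_top sequentially"
    by (rule filterlim_at_top_mono[OF filterlim_ident]) (auto intro: eventually_sequentiallyI[of 1])
  then have "filterlim (\<lambda>m. real (2 * m - 1)) at_top sequentially"
    by (rule filterlim_compose[OF filterlim_real_sequentially])
  then have "(\<lambda>m. 1 / real (2 * m - 1)) \<longlonglongrightarrow> 0"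
    by (intro tendsto_divide_0[OF tendsto_const] filterlim_at_top_imp_at_infinity)
  then have "(\<lambda>m. ?F (1 / real (2 * m - 1))) \<longlonglongrightarrow> ?F 0"
    unfolding moment_functional_def
    by (intro tendsto_sum tendsto_mult tendsto_const tendsto_diff tendsto_avg_op_pow) auto
  moreover have "0 \<le> ?F (1 / real (2 * m - 1))" if "1 \<le> m" for m
    using bernstein_functional_nonneg[OF that cnd refl N] that by (simp add: infinity del: funpow.simps)
  ultimately have "0 \<le> ?F 0"
    by (intro tendsto_lowerbound[of _ _ sequentially 0]) (auto intro: eventually_sequentiallyI[of 1])
  then show ?thesis
    by (simp add: A_def infinity inv_branching_def del: funpow.simps)
qed

text \<open>First comes a measure with moments \<open>V i 0\<close>; two inductions on the length
  then identify the integrals of \<open>sph\<close> with values of \<open>V\<close>, and those of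
  \<open>sph_quot\<close> with \<open>u\<close>.\<close>

lemma integral_representation_exists:
  assumes r: "1 \<le> r" and cnd: "\<And>m. 1 \<le> m \<Longrightarrow> enat m \<le> r \<Longrightarrow> cnd_profile m u" and u0: "u 0 = 0"
  shows "\<exists>\<nu>. sets \<nu> = sets (restrict_space borel {-1..1}) \<and> finite_measure \<nu> \<and>
    (\<forall>n. (LINT s|\<nu>. sph_quot (inv_branching r) s n) = u n)"
proof -
  define t where "t = inv_branching r"
  \<comment> \<open>By linearity, averaging minus the identity applied to \<open>u\<close>, followed
    by \<open>i\<close> averagings.\<close>
  define V where "V i n = (avg_op t ^^ Suc i) u n - (avg_op t ^^ i) u n" for i n
  define L where "L = moment_functional (\<lambda>i. V i 0)"
  have t: "1 + t \<noteq> 0"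
    using inv_branching_nonneg[of r] by (simp add: t_def)
  have "\<exists>\<^sub>\<infinity>N. \<forall>k\<le>N. 0 \<le> L ([:1/2, 1/2:] ^ k * [:1/2, -1/2:] ^ (N - k))"
    unfolding INFM_nat
  proof
    fix n
    show "\<exists>N>n. \<forall>k\<le>N. 0 \<le> L ([:1/2, 1/2:] ^ k * [:1/2, -1/2:] ^ (N - k))"
      using bernstein_functional_nonneg_rank[OF r cnd, of "2 * n + 1"]
      by (intro exI[of _ "2 * n + 1"]) (simp add: L_def V_def t_def del: funpow.simps)
  qed
  then obtain \<nu> where sets: "sets \<nu> = sets (restrict_space borel {-1..1})" and fin: "finite_measure \<nu>"
    and int_poly: "\<And>p. (LINT s|\<nu>. poly p s) = L p"
    using moment_measure_exists[of L] by (auto simp: L_def moment_functional_add moment_functional_smult)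
  have V1: "V i (Suc 0) = V (Suc i) 0" for i
    by (simp add: V_def)
  \<comment> \<open>The recurrence of \<open>sph\<close>, with multiplication by \<open>s\<close>
    replaced by the step from \<open>i\<close> to \<open>Suc i\<close>.\<close>
  have V2: "V i (Suc (Suc n)) = (1 + t) * V (Suc i) (Suc n) - t * V i n" for i n
  proof -
    have "(1 + t) * avg_op t w (Suc n) = w (Suc (Suc n)) + t * w n" for w
      using t by simp
    from this[of "(avg_op t ^^ i) u"] this[of "(avg_op t ^^ Suc i) u"] show ?thesis
      by (simp add: V_def algebra_simps del: avg_op.simps)
  qed
  interpret finite_measure \<nu> by fact
  note int = integrable_interval_measure[OF sets fin]
  have moments: "(LINT s|\<nu>. s ^ i * sph t s n) = V i n" for i n
  proof (induction n arbitrary: i rule: induct_nat_012)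
    case 0
    have "(LINT s|\<nu>. poly (monom 1 i) s) = L (monom 1 i)"
      by (rule int_poly)
    moreover have "L (monom 1 i) = V i 0"
      by (simp add: L_def moment_functional_monom)
    ultimately show ?case
      by (simp add: poly_monom)
  next
    case 1
    have "(LINT s|\<nu>. poly (monom 1 (Suc i)) s) = L (monom 1 (Suc i))"
      by (rule int_poly)
    moreover have "L (monom 1 (Suc i)) = V (Suc i) 0"
      by (simp add: L_def moment_functional_monom)
    ultimately show ?case
      by (simp add: poly_monom V1 mult.commute)
  next
    case (ge2 n)
    have "s ^ i * sph t s (Suc (Suc n)) = (1 + t) * (s ^ Suc i * sph t s (Suc n)) - t * (s ^ i * sph t s n)" for s
      by (simp add: algebra_simps)
    moreover have "(LINT s|\<nu>. (1 + t) * (s ^ Suc i * sph t s (Suc n)) - t * (s ^ i * sph t s n)) =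
        (LINT s|\<nu>. (1 + t) * (s ^ Suc i * sph t s (Suc n))) - (LINT s|\<nu>. t * (s ^ i * sph t s n))"
      by (intro Bochner_Integration.integral_diff int continuous_intros continuous_on_sph)
    ultimately show ?case
      by (simp only: V2 ge2.IH integral_mult_right_zero)
  qed
  have "(LINT s|\<nu>. sph_quot t s n) = u n" for n
  proof (induction n rule: induct_nat_012)
    case 0
    then show ?case
      using u0 by simp
  next
    case 1
    then show ?case
      using moments[of 0 0] u0 by (simp add: V_def)
  next
    case (ge2 n)
    have "(LINT s|\<nu>. (1 + t) * (sph_quot t s (Suc n) + sph t s (Suc n)) - t * sph_quot t s n) =
        (LINT s|\<nu>. (1 + t) * (sph_quot t s (Suc n) + sph t s (Suc n))) - (LINT s|\<nu>. t * sph_quot t s n)"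
      by (intro Bochner_Integration.integral_diff int continuous_intros continuous_on_sph continuous_on_sph_quot)
    moreover have "(LINT s|\<nu>. sph_quot t s (Suc n) + sph t s (Suc n)) =
        (LINT s|\<nu>. sph_quot t s (Suc n)) + (LINT s|\<nu>. sph t s (Suc n))"
      by (intro Bochner_Integration.integral_add int continuous_intros continuous_on_sph continuous_on_sph_quot)
    \<comment> \<open>The integrated form of \<open>sph_quot_Suc\<close>; unfolding
      \<open>V 0\<close> then leaves \<open>u (Suc (Suc n))\<close>.\<close>
    ultimately have "(LINT s|\<nu>. sph_quot t s (Suc (Suc n))) = (1 + t) * (u (Suc n) + V 0 (Suc n)) - t * u n"
      using moments[of 0 "Suc n"] unfolding sph_quot_Suc by (simp only: ge2.IH integral_mult_right_zero power_0 mult_1_left)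
    also have "\<dots> = u (Suc (Suc n))"
      using t by (simp add: V_def)
    finally show ?case .
  qed
  then show ?thesis
    using sets fin unfolding t_def by blast
qed

section \<open>Passage between complex functions on the group and real profiles\<close>

lemma length_inv_free_group:
  "x \<in> carrier (free_group r) \<Longrightarrow> length (inv\<^bsub>free_group r\<^esub> x) = length x"
  by (simp add: inv_free_group)

text \<open>For a symmetric real kernel the mixed terms of real and imaginary parts cancel.\<close>

lemma complex_quadratic_form:
  fixes n :: nat
  assumes sym: "\<And>j k. j < n \<Longrightarrow> k < n \<Longrightarrow> K j k = (K k j :: real)"
  shows "(\<Sum>j<n. \<Sum>k<n. c j * cnj (c k) * complex_of_real (K j k)) =
    complex_of_real ((\<Sum>j<n. \<Sum>k<n. Re (c j) * Re (c k) * K j k) + (\<Sum>j<n. \<Sum>k<n. Im (c j) * Im (c k) * K j k))"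
proof (rule complex_eqI)
  have "(\<Sum>j<n. \<Sum>k<n. Im (c j) * Re (c k) * K j k) = (\<Sum>j<n. \<Sum>k<n. Re (c j) * Im (c k) * K j k)"
    by (subst sum.swap, intro sum.cong refl) (auto simp: sym)
  then show "Im (\<Sum>j<n. \<Sum>k<n. c j * cnj (c k) * complex_of_real (K j k)) =
      Im (complex_of_real ((\<Sum>j<n. \<Sum>k<n. Re (c j) * Re (c k) * K j k) + (\<Sum>j<n. \<Sum>k<n. Im (c j) * Im (c k) * K j k)))"
    by (simp add: left_diff_distrib sum_subtractf)
qed (simp add: distrib_right sum.distrib)

text \<open>An element and its inverse have equal length, so \<open>\<psi>\<close> equals its
  conjugate and is real; real coefficients and words in the first \<open>m\<close> generators then
  give \<open>cnd_profile\<close>.\<close>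

lemma cond_neg_def_imp_profile:
  assumes r: "1 \<le> r" and rad: "radial r \<psi>" and cnd: "cond_neg_def (free_group r) \<psi>"
  obtains u where "\<And>x. x \<in> carrier (free_group r) \<Longrightarrow> \<psi> x = complex_of_real (u (length x))"
    and "\<And>m. enat m \<le> r \<Longrightarrow> cnd_profile m u"
proof -
  interpret group "free_group r"
    by (rule group_free_group)
  let ?C = "carrier (free_group r)"
  define u where "u n = Re (\<psi> (replicate n (0, True)))" for n
  have u: "\<psi> x = complex_of_real (u (length x))" if x: "x \<in> ?C" for x
  proof -
    have "\<psi> (inv\<^bsub>free_group r\<^esub> x) = \<psi> x"
      using rad x inv_closed[OF x] length_inv_free_group[OF x] unfolding radial_def by blast
    moreover have "\<psi> (inv\<^bsub>free_group r\<^esub> x) = cnj (\<psi> x)"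
      using cnd x unfolding cond_neg_def_def by blast
    ultimately have "\<psi> x \<in> \<real>"
      by (simp add: Reals_cnj_iff)
    then have "\<psi> x = complex_of_real (Re (\<psi> x))"
      by (simp add: of_real_Re)
    moreover have "\<psi> x = \<psi> (replicate (length x) (0, True))"
      using rad x replicate_in_carrier[OF r] length_replicate unfolding radial_def by metis
    ultimately show ?thesis
      by (simp add: u_def)
  qed
  moreover have "cnd_profile m u" if "enat m \<le> r" for m
    unfolding cnd_profile_def
  proof (intro allI impI, elim conjE)
    fix n :: nat and x :: "nat \<Rightarrow> fword" and c :: "nat \<Rightarrow> real"
    assume "\<forall>j<n. x j \<in> carrier (free_group (enat m))" and c: "(\<Sum>j<n. c j) = 0"
    moreover have "letters (enat m) \<subseteq> letters r"
      using order_less_le_trans[OF _ that] by (auto simp: letters_def)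
    ultimately have x: "x j \<in> ?C" if "j < n" for j
      using that by (auto simp: free_group_def)
    have "(\<Sum>j<n. complex_of_real (c j)) = 0"
      using c by (simp flip: of_real_sum)
    then have "(\<Sum>j<n. \<Sum>k<n. complex_of_real (c j) * cnj (complex_of_real (c k)) *
        \<psi> (inv\<^bsub>free_group r\<^esub> (x k) \<otimes>\<^bsub>free_group r\<^esub> x j)) \<in> \<real>\<^sub>\<le>\<^sub>0"
      using x by (intro cnd[unfolded cond_neg_def_def, THEN conjunct2, THEN spec, THEN spec, THEN spec, THEN mp]) simp
    also have "(\<Sum>j<n. \<Sum>k<n. complex_of_real (c j) * cnj (complex_of_real (c k)) *
        \<psi> (inv\<^bsub>free_group r\<^esub> (x k) \<otimes>\<^bsub>free_group r\<^esub> x j)) =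
        complex_of_real (\<Sum>j<n. \<Sum>k<n. c j * c k * u (fdist (x j) (x k)))"
      using x by (simp add: u fdist_eq[where r = r])
    finally show "(\<Sum>j<n. \<Sum>k<n. c j * c k * u (fdist (x j) (x k))) \<le> 0"
      by (simp only: nonpos_Reals_of_real_iff)
  qed
  ultimately show ?thesis
    by (rule that)
qed

text \<open>\<open>sph_quot_cond_negative\<close> is integrated over \<open>s\<close>, separately
  for real and imaginary parts of the coefficients.\<close>

lemma represents_imp_cond_neg_def:
  assumes r: "1 \<le> r" and rep: "represents r \<nu> \<psi>"
  shows "cond_neg_def (free_group r) \<psi>"
proof -
  interpret group "free_group r"
    by (rule group_free_group)
  let ?C = "carrier (free_group r)" and ?w = "sph_quot (inv_branching r)"
  define U where "U n = (LINT s|\<nu>. ?w s n)" for n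
  have sets: "sets \<nu> = sets (restrict_space borel {-1..1})" and fin: "finite_measure \<nu>"
    and \<psi>: "\<And>x. x \<in> ?C \<Longrightarrow> \<psi> x = complex_of_real (U (length x))"
    using rep unfolding represents_iff[OF r] U_def by auto
  interpret finite_measure \<nu> by fact
  have int: "integrable \<nu> (\<lambda>s. ?w s n)" for n
    by (intro integrable_interval_measure[OF sets fin] continuous_on_sph_quot continuous_intros)
  have neg: "(\<Sum>j<n. \<Sum>k<n. c j * c k * U (fdist (x j) (x k))) \<le> 0"
    if x: "\<And>j. j < n \<Longrightarrow> x j \<in> ?C" and c: "(\<Sum>j<n. c j) = 0"
    for n :: nat and x and c :: "nat \<Rightarrow> real"
  proof -
    have "(\<Sum>j<n. \<Sum>k<n. c j * c k * U (fdist (x j) (x k))) =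
        (LINT s|\<nu>. (\<Sum>j<n. \<Sum>k<n. c j * c k * ?w s (fdist (x j) (x k))))"
      by (simp add: U_def int Bochner_Integration.integral_sum)
    also have "\<dots> \<le> (LINT s|\<nu>. 0)"
    proof (rule integral_mono)
      show "(\<Sum>j<n. \<Sum>k<n. c j * c k * ?w s (fdist (x j) (x k))) \<le> 0" if "s \<in> space \<nu>" for s
        using that by (intro sph_quot_cond_negative r x c) (auto simp: space_interval_measure[OF sets fin])
    qed (simp_all add: int)
    finally show ?thesis
      by simp
  qed
  show ?thesis
    unfolding cond_neg_def_def
  proof (intro conjI ballI allI impI)
    fix x assume "x \<in> ?C"
    then show "\<psi> (inv\<^bsub>free_group r\<^esub> x) = cnj (\<psi> x)"
      by (simp add: \<psi> length_inv_free_group)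
  next
    fix n :: nat and x :: "nat \<Rightarrow> fword" and c :: "nat \<Rightarrow> complex"
    assume *: "(\<forall>j<n. x j \<in> ?C) \<and> (\<Sum>j<n. c j) = 0"
    then have x: "x j \<in> ?C" if "j < n" for j
      using that by blast
    have c: "(\<Sum>j<n. Re (c j)) = 0" "(\<Sum>j<n. Im (c j)) = 0"
      using * by (simp_all flip: Re_sum Im_sum)
    have "(\<Sum>j<n. \<Sum>k<n. c j * cnj (c k) * \<psi> (inv\<^bsub>free_group r\<^esub> (x k) \<otimes>\<^bsub>free_group r\<^esub> x j)) =
        (\<Sum>j<n. \<Sum>k<n. c j * cnj (c k) * complex_of_real (U (fdist (x j) (x k))))"
      using x by (simp add: \<psi> fdist_eq[where r = r])
    also have "\<dots> = complex_of_real ((\<Sum>j<n. \<Sum>k<n. Re (c j) * Re (c k) * U (fdist (x j) (x k))) +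
        (\<Sum>j<n. \<Sum>k<n. Im (c j) * Im (c k) * U (fdist (x j) (x k))))"
      using x by (intro complex_quadratic_form) (simp add: fdist_commute free_group_def)
    also have "\<dots> \<in> \<real>\<^sub>\<le>\<^sub>0"
      unfolding nonpos_Reals_of_real_iff by (intro add_nonpos_nonpos neg x c)
    finally show "(\<Sum>j<n. \<Sum>k<n. c j * cnj (c k) * \<psi> (inv\<^bsub>free_group r\<^esub> (x k) \<otimes>\<^bsub>free_group r\<^esub> x j)) \<in> \<real>\<^sub>\<le>\<^sub>0" .
  qed
qed

theorem theorem1p2:
  fixes r :: enat and \<psi> :: "fword \<Rightarrow> complex"
  assumes "2 \<le> r"
    and "radial r \<psi>"
    and "\<psi> \<one>\<^bsub>free_group r\<^esub> = 0"
  shows "(cond_neg_def (free_group r) \<psi> \<longleftrightarrow> (\<exists>\<nu>. represents r \<nu> \<psi>)) \<and>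
    (\<forall>\<nu>. represents r \<nu> \<psi> \<longrightarrow>
      (\<forall>\<nu>'. represents r \<nu>' \<psi> \<longrightarrow> \<nu>' = \<nu>) \<and>
      (\<forall>x\<in>carrier (free_group r). length x = 1 \<longrightarrow> complex_of_real (measure \<nu> {-1..1}) = \<psi> x))"
proof -
  have r: "1 \<le> r"
    using assms(1) by (rule order_trans[rotated]) simp
  have "\<exists>\<nu>. represents r \<nu> \<psi>" if cnd: "cond_neg_def (free_group r) \<psi>"
  proof -
    obtain u where u: "\<And>x. x \<in> carrier (free_group r) \<Longrightarrow> \<psi> x = complex_of_real (u (length x))"
      and prof: "\<And>m. enat m \<le> r \<Longrightarrow> cnd_profile m u"
      using cond_neg_def_imp_profile[OF r assms(2) cnd] by blast
    have "u 0 = 0"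
      using u[of "[]"] assms(3) by (simp add: free_group_def)
    from integral_representation_exists[OF r prof this]
    obtain \<nu> where "sets \<nu> = sets (restrict_space borel {-1..1})" "finite_measure \<nu>"
      and "\<And>n. (LINT s|\<nu>. sph_quot (inv_branching r) s n) = u n"
      by blast
    then show ?thesis
      using u by (intro exI[of _ \<nu>]) (simp add: represents_iff[OF r])
  qed
  moreover have "cond_neg_def (free_group r) \<psi>" if "represents r \<nu> \<psi>" for \<nu>
    using that by (rule represents_imp_cond_neg_def[OF r])
  moreover have "\<nu>' = \<nu>" if "represents r \<nu> \<psi>" "represents r \<nu>' \<psi>" for \<nu> \<nu>'
    using that(2,1) by (rule represents_unique[OF r])
  moreover have "complex_of_real (measure \<nu> {-1..1}) = \<psi> x"
    if "represents r \<nu> \<psi>" "x \<in> carrier (free_group r)" "length x = 1" for \<nu> x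
    using that by (rule represents_total_mass[OF r])
  ultimately show ?thesis
    by blast
qed

end
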